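(* The Cauchy problem $$\begin{cases}f_t(t,y)+\frac12 f_{yy}(t,y)\frac{\gamma^2(t)}{\sigma^2}+f_y(t,y)\frac{\gamma(t)(r-y)}{\sigma^2}\\ \quad-\Big[\frac{(r-y+a\sqrt{\gamma(t)})^2}{2\sigma^2}I_{\{r-y+a\sqrt{\gamma(t)}\le0\}}+\frac{(r-y-a\sqrt{\gamma(t)})^2}{2\sigma^2}I_{\{r-y-a\sqrt{\gamma(t)}\ge0\}}\Big]=0,&(t,y)\in[0,T)\times\mathbb{R},\\ f(T,y)=0,&y\in\mathbb{R},\end{cases}$$ has a unique solution $f$ of class $C^{1,2}([0,T)\times\mathbb{R})\cap C([0,T]\times\mathbb{R})$ which satisfies the polynomial growth condition $$\max_{0\le t\le T}|f(t,y)|\le C_1(1+y^2),\quad\forall y\in\mathbb{R},$$ for some constant $C_1>0$. Moreover, the partial derivative $f_y$ satisfies $$\max_{0\le t\le T}|f_y(t,y)|\le C_2(1+|y|),\quad\forall y\in\mathbb{R},$$ for some constant $C_2>0$.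
   Context: Constants: $T>0$, $\sigma>0$, $\sigma_0>0$, $a\ge0$, $r\in\mathbb{R}$. $\gamma(t)=(\sigma_0^{-2}+t\sigma^{-2})^{-1}$ for $t\in[0,T]$. Subscripts denote partial derivatives and $I_{\{\cdot\}}$ is the indicator. *)

theory Defs
  imports "HOL-Analysis.Analysis"
begin

definition gam :: "real \<Rightarrow> real \<Rightarrow> real \<Rightarrow> real" where
  "gam \<sigma> \<sigma>\<^sub>0 t = 1 / (1 / \<sigma>\<^sub>0\<^sup>2 + t / \<sigma>\<^sup>2)"

text \<open>
  A function of \<open>(t, y)\<close> is a curried \<open>f :: real \<Rightarrow> real \<Rightarrow> real\<close>, of which only the
  values for \<open>0 \<le> t \<le> T\<close> matter. The time derivative is therefore taken within
  \<open>{0..<T}\<close>: one-sided at \<open>t = 0\<close>, two-sided for \<open>0 < t < T\<close>.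
\<close>

definition D_t :: "real \<Rightarrow> (real \<Rightarrow> real \<Rightarrow> real) \<Rightarrow> real \<Rightarrow> real \<Rightarrow> real" where
  "D_t T f t y = vector_derivative (\<lambda>s. f s y) (at t within {0..<T})"

definition D_y :: "(real \<Rightarrow> real \<Rightarrow> real) \<Rightarrow> real \<Rightarrow> real \<Rightarrow> real" where
  "D_y f t y = deriv (\<lambda>x. f t x) y"

text \<open>
  \<open>D_t\<close> and \<open>D_y\<close> have unspecified values where the derivative does not exist, so
  differentiability is required explicitly.
\<close>

definition C12 :: "real \<Rightarrow> (real \<Rightarrow> real \<Rightarrow> real) \<Rightarrow> bool" where
  "C12 T f \<longleftrightarrow>
     (\<forall>t\<in>{0..<T}. \<forall>y.
        (\<lambda>s. f s y) differentiable (at t within {0..<T}) \<and>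
        (\<lambda>x. f t x) differentiable (at y) \<and>
        (\<lambda>x. D_y f t x) differentiable (at y)) \<and>
     continuous_on ({0..<T} \<times> UNIV) (\<lambda>(t, y). f t y) \<and>
     continuous_on ({0..<T} \<times> UNIV) (\<lambda>(t, y). D_t T f t y) \<and>
     continuous_on ({0..<T} \<times> UNIV) (\<lambda>(t, y). D_y f t y) \<and>
     continuous_on ({0..<T} \<times> UNIV) (\<lambda>(t, y). D_y (D_y f) t y)"

definition source :: "real \<Rightarrow> real \<Rightarrow> real \<Rightarrow> real \<Rightarrow> real \<Rightarrow> real \<Rightarrow> real" where
  "source \<sigma> \<sigma>\<^sub>0 a r t y =
     (r - y + a * sqrt (gam \<sigma> \<sigma>\<^sub>0 t))\<^sup>2 / (2 * \<sigma>\<^sup>2)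
       * of_bool (r - y + a * sqrt (gam \<sigma> \<sigma>\<^sub>0 t) \<le> 0)
   + (r - y - a * sqrt (gam \<sigma> \<sigma>\<^sub>0 t))\<^sup>2 / (2 * \<sigma>\<^sup>2)
       * of_bool (r - y - a * sqrt (gam \<sigma> \<sigma>\<^sub>0 t) \<ge> 0)"

definition solves_cauchy ::
  "real \<Rightarrow> real \<Rightarrow> real \<Rightarrow> real \<Rightarrow> real \<Rightarrow> (real \<Rightarrow> real \<Rightarrow> real) \<Rightarrow> bool" where
  "solves_cauchy T \<sigma> \<sigma>\<^sub>0 a r f \<longleftrightarrow>
     (\<forall>t\<in>{0..<T}. \<forall>y.
        D_t T f t y
        + 1 / 2 * D_y (D_y f) t y * ((gam \<sigma> \<sigma>\<^sub>0 t)\<^sup>2 / \<sigma>\<^sup>2)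
        + D_y f t y * (gam \<sigma> \<sigma>\<^sub>0 t * (r - y) / \<sigma>\<^sup>2)
        - source \<sigma> \<sigma>\<^sub>0 a r t y = 0) \<and>
     (\<forall>y. f T y = 0)"

definition quadratic_growth :: "real \<Rightarrow> (real \<Rightarrow> real \<Rightarrow> real) \<Rightarrow> bool" where
  "quadratic_growth T f \<longleftrightarrow>
     (\<exists>C\<^sub>1>0. \<forall>y. \<forall>t\<in>{0..T}. \<bar>f t y\<bar> \<le> C\<^sub>1 * (1 + y\<^sup>2))"

definition admissible_solution ::
  "real \<Rightarrow> real \<Rightarrow> real \<Rightarrow> real \<Rightarrow> real \<Rightarrow> (real \<Rightarrow> real \<Rightarrow> real) \<Rightarrow> bool" where
  "admissible_solution T \<sigma> \<sigma>\<^sub>0 a r f \<longleftrightarrow>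
     C12 T f \<and> continuous_on ({0..T} \<times> UNIV) (\<lambda>(t, y). f t y) \<and>
     solves_cauchy T \<sigma> \<sigma>\<^sub>0 a r f \<and> quadratic_growth T f"

end

theory Submission
  imports Defs "HOL-Probability.Characteristic_Functions"
begin

text \<open>
  Put \<open>x = (y - r) / \<gamma>(t)\<close>. Since \<open>(1 / \<gamma>)' = 1 / \<sigma>\<^sup>2\<close>, the drift cancels and the equation becomes a
  backward heat equation \<open>F_t + F_xx / (2 * \<sigma>\<^sup>2) = Q(t, x)\<close>, where \<open>Q\<close> is a combination of the two squares
  \<open>(max 0 (\<plusminus>x - b(t)))\<^sup>2\<close>. The heat flow of \<open>(max 0 u)\<^sup>2\<close> is explicit in terms of the normal distribution
  function, so Duhamel's formula gives \<open>F\<close> as a one-dimensional integral in time. Its second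
  \<open>x\<close>-derivative has a bounded integrand, discontinuous at a single time, and dominated convergence
  yields all derivatives and their continuity. Uniqueness is a maximum
  principle, where the mean reversion of the drift has the favourable sign.
\<close>

section \<open>The heat flow of a truncated square\<close>

text \<open>For \<open>a > 0\<close> the source is only \<open>C^1\<close> in \<open>y\<close>: its
  second derivative jumps at the two thresholds. A classical solution nevertheless needs
  \<open>F_t\<close> and \<open>F_xx\<close>, and for a general source the twice differentiated heat
  kernel is singular on the diagonal \<open>s = t\<close> of Duhamel's formula. Here both
  derivatives can be put on the datum: the heat flow of \<open>(max 0 u)^2\<close> has second
  derivative \<open>2 * Phi\<close>, bounded by 2 uniformly as the elapsed time tends to 0, and its
  time derivative is half of that. So no singular integral arises. Weight and threshold depend on
  time, but are frozen at the source time \<open>s\<close> and enter only as continuous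
  coefficients. The two squares are exchanged by \<open>x -> -x\<close>, so a single one is studied
  and then reflected. Uniqueness compares with a quartic because the difference of two solutions may
  itself grow quadratically.\<close>

abbreviation (input) phi :: "real \<Rightarrow> real" where "phi \<equiv> std_normal_density"

section \<open>Density and distribution function of the standard normal law\<close>

definition Phi :: "real \<Rightarrow> real" where "Phi = cdf std_normal_distribution"

lemma phi_bounds: "0 \<le> phi x" "phi x \<le> 1"
proof -
  have "1 \<le> sqrt (2 * pi)"
    using pi_gt3 by (simp add: real_le_rsqrt)
  moreover have "exp (- (x\<^sup>2 / 2)) \<le> 1" by simp
  ultimately show "phi x \<le> 1"
    unfolding std_normal_density_def
    using order.trans[of "exp (- (x\<^sup>2 / 2))" 1 "sqrt (2 * pi)"] by (simp add: divide_le_eq)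
qed (simp add: normal_density_nonneg)

lemma Phi_bounds: "0 \<le> Phi x" "Phi x \<le> 1"
proof -
  interpret real_distribution std_normal_distribution
    by (rule real_dist_normal_dist)
  show "0 \<le> Phi x" "Phi x \<le> 1"
    unfolding Phi_def by (rule cdf_nonneg, rule cdf_bounded_prob)
qed

lemma Phi_at_top: "(Phi \<longlongrightarrow> 1) at_top" and Phi_at_bot: "(Phi \<longlongrightarrow> 0) at_bot"
proof -
  interpret real_distribution std_normal_distribution
    by (rule real_dist_normal_dist)
  show "(Phi \<longlongrightarrow> 1) at_top" "(Phi \<longlongrightarrow> 0) at_bot"
    unfolding Phi_def by (rule cdf_lim_at_top_prob, rule cdf_lim_at_bot)
qed

lemma DERIV_phi: "(phi has_real_derivative - x * phi x) (at x)"
  unfolding std_normal_density_def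
  by (auto intro!: derivative_eq_intros simp: field_simps)

lemma continuous_on_phi: "continuous_on A phi"
  using DERIV_phi DERIV_isCont continuous_at_imp_continuous_on by blast

text \<open>On a window around \<open>x\<close>, \<open>Phi\<close> is a constant plus the ordinary
  integral of the density, since the left endpoint is a null set; the fundamental theorem of
  calculus then applies.\<close>

lemma DERIV_Phi: "(Phi has_real_derivative phi x) (at x)"
proof -
  interpret real_distribution std_normal_distribution
    by (rule real_dist_normal_dist)
  have *: "Phi y = Phi (x - 1) + integral {x - 1..y} phi" if "y \<in> {x - 1<..<x + 1}" for y
  proof -
    have si: "set_integrable lborel {x - 1..y} phi"
      by (intro borel_integrable_atLeastAtMost' continuous_on_phi)
    have "Phi y - Phi (x - 1) = measure std_normal_distribution {x - 1<..y}"
      unfolding Phi_def using that by (intro cdf_diff_eq) auto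
    also have "\<dots> = (\<integral>z. indicator {x - 1<..y} z \<partial>std_normal_distribution)"
      by simp
    also have "\<dots> = (\<integral>z. phi z *\<^sub>R indicator {x - 1<..y} z \<partial>lborel)"
      by (intro integral_density) (auto simp: normal_density_nonneg)
    also have "\<dots> = (LINT z:{x - 1..y}|lborel. phi z)"
      unfolding set_lebesgue_integral_def
      by (intro integral_cong_AE)
        (auto intro!: eventually_mono[OF AE_lborel_singleton[of "x - 1"]] simp: indicator_def)
    also have "\<dots> = integral {x - 1..y} phi"
      by (rule set_borel_integral_eq_integral[OF si])
    finally show ?thesis by simp
  qed
  have "((\<lambda>y. integral {x - 1..y} phi) has_real_derivative phi x) (at x within {x - 1..x + 1})"
    by (intro integral_has_real_derivative continuous_on_phi) auto
  then have "((\<lambda>y. Phi (x - 1) + integral {x - 1..y} phi) has_real_derivative phi x) (at x)"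
    by (auto simp: at_within_Icc_at intro!: derivative_eq_intros)
  then show ?thesis
    by (rule has_field_derivative_transform_within_open[where S="{x - 1<..<x + 1}"])
      (auto simp: *)
qed

lemmas DERIV_Phi' [derivative_intros] = DERIV_chain2[OF DERIV_Phi]
lemmas DERIV_phi' [derivative_intros] = DERIV_chain2[OF DERIV_phi]

lemma isCont_Phi: "isCont Phi x"
  using DERIV_Phi DERIV_isCont by blast

lemma Phi_measurable [measurable]: "Phi \<in> borel_measurable borel"
  by (intro borel_measurable_continuous_onI continuous_at_imp_continuous_on) (simp add: isCont_Phi)

text \<open>For a standard normal variable \<open>Z\<close> these are \<open>E [max 0 (u + sqrt \<tau> * Z) ^ 2]\<close> and its
  first two derivatives in \<open>u\<close>. They are meaningful only for \<open>\<tau> > 0\<close>: at \<open>\<tau> = 0\<close> the division by zero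
  puts \<open>Phi 0\<close> in place of the indicator of \<open>u > 0\<close>.\<close>

definition ker :: "real \<Rightarrow> real \<Rightarrow> real" where
  "ker \<tau> u = (u\<^sup>2 + \<tau>) * Phi (u / sqrt \<tau>) + sqrt \<tau> * u * phi (u / sqrt \<tau>)"

definition ker_u :: "real \<Rightarrow> real \<Rightarrow> real" where
  "ker_u \<tau> u = 2 * (u * Phi (u / sqrt \<tau>) + sqrt \<tau> * phi (u / sqrt \<tau>))"

definition ker_uu :: "real \<Rightarrow> real \<Rightarrow> real" where
  "ker_uu \<tau> u = 2 * Phi (u / sqrt \<tau>)"

lemma ker_measurable [measurable]:
  assumes [measurable]: "f \<in> borel_measurable M" "g \<in> borel_measurable M"
  shows "(\<lambda>s. ker (f s) (g s)) \<in> borel_measurable M"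
    "(\<lambda>s. ker_u (f s) (g s)) \<in> borel_measurable M"
    "(\<lambda>s. ker_uu (f s) (g s)) \<in> borel_measurable M"
  unfolding ker_def ker_u_def ker_uu_def by measurable

lemma DERIV_ker: "((\<lambda>u. ker \<tau> u) has_real_derivative ker_u \<tau> u) (at u)" if "\<tau> > 0"
proof -
  \<comment> \<open>Writing \<open>\<tau> = c^2\<close> removes the square roots, so that the
    remaining identity is rational in \<open>c\<close>.\<close>
  define c where "c = sqrt \<tau>"
  have c: "c > 0" "\<tau> = c\<^sup>2" "sqrt (c\<^sup>2) = c"
    using that by (auto simp: c_def)
  show ?thesis
    unfolding ker_def ker_u_def c(2) c(3) using c(1)
    by (auto intro!: derivative_eq_intros simp: field_simps power2_eq_square)
qed

lemma DERIV_ker_u: "((\<lambda>u. ker_u \<tau> u) has_real_derivative ker_uu \<tau> u) (at u)" if "\<tau> > 0"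
proof -
  define c where "c = sqrt \<tau>"
  have c: "c > 0" "\<tau> = c\<^sup>2" "sqrt (c\<^sup>2) = c"
    using that by (auto simp: c_def)
  show ?thesis
    unfolding ker_u_def ker_uu_def c(2) c(3) using c(1)
    by (auto intro!: derivative_eq_intros simp: field_simps power2_eq_square)
qed

text \<open>This is the heat equation for \<open>ker\<close>. Differentiation produces three
  multiples of \<open>phi (u / c)\<close>, namely \<open>-(u^2 + c^2) * u / (2 * c^3)\<close>,
  \<open>u / (2 * c)\<close> and \<open>u^3 / (2 * c^3)\<close>; they cancel and only
  \<open>Phi (u / c)\<close> remains.\<close>

lemma DERIV_ker_time:
  "((\<lambda>\<tau>. ker \<tau> u) has_real_derivative ker_uu \<tau> u / 2) (at \<tau>)" if "\<tau> > 0"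
proof -
  define c where "c = sqrt \<tau>"
  have c: "c > 0" "\<tau> = c\<^sup>2" "sqrt (c\<^sup>2) = c"
    using that by (auto simp: c_def)
  have "((\<lambda>\<tau>. ker \<tau> u) has_real_derivative
      Phi (u / c) + (u\<^sup>2 + \<tau>) * (phi (u / c) * (- u / (2 * c ^ 3)))
      + (u * phi (u / c) / (2 * c) + c * u * (- (u / c) * phi (u / c) * (- u / (2 * c ^ 3))))) (at \<tau>)"
    unfolding ker_def using c that unfolding c_def
    by (auto intro!: derivative_eq_intros simp: field_simps power2_eq_square power3_eq_cube)
  also have "Phi (u / c) + (u\<^sup>2 + \<tau>) * (phi (u / c) * (- u / (2 * c ^ 3)))
      + (u * phi (u / c) / (2 * c) + c * u * (- (u / c) * phi (u / c) * (- u / (2 * c ^ 3))))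
      = ker_uu \<tau> u / 2"
    unfolding ker_uu_def c(2) c(3) using c(1) by (simp add: field_simps power2_eq_square power3_eq_cube)
  finally show ?thesis .
qed

section \<open>Growth of the flow and its limit at time 0\<close>

lemma ker_bound: "\<bar>ker \<tau> u\<bar> \<le> 2 * (u\<^sup>2 + \<tau>)" if "\<tau> \<ge> 0"
proof -
  have "\<bar>(u\<^sup>2 + \<tau>) * Phi (u / sqrt \<tau>)\<bar> \<le> u\<^sup>2 + \<tau>"
    using Phi_bounds[of "u / sqrt \<tau>"] that by (auto simp: abs_mult intro!: mult_left_le)
  moreover have "\<bar>sqrt \<tau> * u * phi (u / sqrt \<tau>)\<bar> \<le> \<bar>sqrt \<tau> * u\<bar>"
    using phi_bounds[of "u / sqrt \<tau>"] by (auto simp: abs_mult intro!: mult_left_le)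
  moreover have "2 * \<bar>sqrt \<tau> * u\<bar> \<le> u\<^sup>2 + \<tau>"
    using that sum_squares_bound[of "sqrt \<tau>" "\<bar>u\<bar>"] by (auto simp: abs_mult)
  ultimately show ?thesis
    unfolding ker_def using that by (smt (verit) zero_le_power2)
qed

lemma ker_u_bound: "\<bar>ker_u \<tau> u\<bar> \<le> 2 * (\<bar>u\<bar> + sqrt \<tau>)" if "\<tau> \<ge> 0"
proof -
  have "\<bar>u * Phi (u / sqrt \<tau>)\<bar> \<le> \<bar>u\<bar>"
    using Phi_bounds[of "u / sqrt \<tau>"] that by (auto simp: abs_mult intro!: mult_left_le)
  moreover have "\<bar>sqrt \<tau> * phi (u / sqrt \<tau>)\<bar> \<le> sqrt \<tau>"
    using phi_bounds[of "u / sqrt \<tau>"] that by (auto simp: abs_mult intro!: mult_left_le)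
  ultimately show ?thesis
    unfolding ker_u_def by (smt (verit))
qed

lemma ker_uu_bound: "\<bar>ker_uu \<tau> u\<bar> \<le> 2"
  using Phi_bounds unfolding ker_uu_def by auto

text \<open>As \<open>\<tau>\<close> decreases to 0, \<open>u / sqrt \<tau>\<close> diverges with
  the sign of \<open>u\<close>, so \<open>Phi\<close> tends to the indicator of
  \<open>u > 0\<close>; at \<open>u = 0\<close> the factor \<open>u^2 + \<tau>\<close> vanishes
  instead. The density term is at most \<open>sqrt \<tau> * \<bar>u\<bar>\<close>.\<close>

lemma ker_at_0: "((\<lambda>\<tau>. ker \<tau> u) \<longlongrightarrow> (max 0 u)\<^sup>2) (at_right 0)"
proof -
  have s: "((\<lambda>\<tau>. sqrt \<tau>) \<longlongrightarrow> 0) (at_right 0)"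
    by (auto intro!: tendsto_eq_intros)
  have s0: "filterlim (\<lambda>\<tau>. sqrt \<tau>) (at_right 0) (at_right 0)"
    using s eventually_at_right_less[of "0::real"] by (auto simp: filterlim_at elim: eventually_mono)
  have inv: "filterlim (\<lambda>\<tau>. inverse (sqrt \<tau>)) at_top (at_right 0)"
    using filterlim_compose[OF filterlim_inverse_at_top_right s0] .
  have 1: "((\<lambda>\<tau>. (u\<^sup>2 + \<tau>) * Phi (u / sqrt \<tau>)) \<longlongrightarrow> (max 0 u)\<^sup>2) (at_right 0)"
  proof (cases "u = 0")
    case True
    then show ?thesis by (auto intro!: tendsto_eq_intros)
  next
    case False
    show ?thesis
    proof (cases "u > 0")
      case True
      have "filterlim (\<lambda>\<tau>. u / sqrt \<tau>) at_top (at_right 0)"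
        using filterlim_tendsto_pos_mult_at_top[OF tendsto_const True inv] by (simp add: field_simps)
      then have "((\<lambda>\<tau>. Phi (u / sqrt \<tau>)) \<longlongrightarrow> 1) (at_right 0)"
        by (rule filterlim_compose[OF Phi_at_top])
      then show ?thesis using True by (auto intro!: tendsto_eq_intros)
    next
      case neg: False
      have "filterlim (\<lambda>\<tau>. u / sqrt \<tau>) at_bot (at_right 0)"
        using filterlim_tendsto_neg_mult_at_bot[OF tendsto_const _ inv, of u] neg False
        by (simp add: field_simps)
      then have "((\<lambda>\<tau>. Phi (u / sqrt \<tau>)) \<longlongrightarrow> 0) (at_right 0)"
        by (rule filterlim_compose[OF Phi_at_bot])
      then show ?thesis using neg by (auto intro!: tendsto_eq_intros)
    qed
  qed
  have 2: "((\<lambda>\<tau>. sqrt \<tau> * u * phi (u / sqrt \<tau>)) \<longlongrightarrow> 0) (at_right 0)"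
  proof (rule Lim_null_comparison)
    show "\<forall>\<^sub>F \<tau> in at_right 0. norm (sqrt \<tau> * u * phi (u / sqrt \<tau>)) \<le> sqrt \<tau> * \<bar>u\<bar>"
      using eventually_at_right_less[of "0::real"]
    proof eventually_elim
      case (elim \<tau>)
      have "(sqrt \<tau> * \<bar>u\<bar>) * phi (u / sqrt \<tau>) \<le> sqrt \<tau> * \<bar>u\<bar>"
        using phi_bounds[of "u / sqrt \<tau>"] elim by (intro mult_left_le) auto
      then show ?case using elim phi_bounds(1)[of "u / sqrt \<tau>"] by (simp add: abs_mult)
    qed
    show "((\<lambda>\<tau>. sqrt \<tau> * \<bar>u\<bar>) \<longlongrightarrow> 0) (at_right 0)"
      by (auto intro!: tendsto_eq_intros)
  qed
  show ?thesis unfolding ker_def using tendsto_add[OF 1 2] by simp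
qed

text \<open>For \<open>u \<ge> 0\<close> the continuation has a corner at \<open>\<tau> = 0\<close>,
  with left derivative 0, but it stays Lipschitz there, and a single bad time is harmless under the
  integral.\<close>

definition ker_ext :: "real \<Rightarrow> real \<Rightarrow> real" where
  "ker_ext \<tau> u = (if \<tau> > 0 then ker \<tau> u else (max 0 u)\<^sup>2)"

lemma DERIV_ker_ext:
  assumes "\<tau> \<noteq> 0"
  shows "((\<lambda>\<tau>. ker_ext \<tau> u) has_real_derivative (if \<tau> > 0 then ker_uu \<tau> u / 2 else 0)) (at \<tau>)"
proof (cases "\<tau> > 0")
  case True
  have "((\<lambda>\<tau>. ker_ext \<tau> u) has_real_derivative ker_uu \<tau> u / 2) (at \<tau>)"
    using DERIV_ker_time[OF True]
    by (rule has_field_derivative_transform_within_open[where S="{0<..}"])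
      (use True in \<open>auto simp: ker_ext_def\<close>)
  then show ?thesis using True by simp
next
  case False
  have "((\<lambda>\<tau>. ker_ext \<tau> u) has_real_derivative 0) (at \<tau>)"
    using DERIV_const[of "(max 0 u)\<^sup>2"]
    by (rule has_field_derivative_transform_within_open[where S="{..<0}"])
      (use False assms in \<open>auto simp: ker_ext_def\<close>)
  then show ?thesis using False by simp
qed

text \<open>For positive times the derivative \<open>ker_uu / 2\<close> is at most 1 in absolute
  value, and continuity at 0 lets the mean value theorem start there. For nonpositive times the
  function is constant, so a pair on both sides of 0 is compared through 0.\<close>

lemma ker_ext_mono_lipschitz:
  assumes "\<tau>1 < \<tau>2"
  shows "\<bar>ker_ext \<tau>2 u - ker_ext \<tau>1 u\<bar> \<le> \<tau>2 - \<tau>1"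
proof -
  have pos: "\<bar>ker_ext y u - ker_ext x u\<bar> \<le> y - x" if "0 \<le> x" "x < y" for x y
  proof -
    have d: "((\<lambda>\<tau>. ker_ext \<tau> u) has_real_derivative ker_uu z u / 2) (at z)" if "z > 0" for z
      using DERIV_ker_ext[of z u] that by simp
    have "continuous_on {x..y} (\<lambda>\<tau>. ker_ext \<tau> u)"
      unfolding continuous_on_eq_continuous_within
    proof
      fix z assume z: "z \<in> {x..y}"
      show "continuous (at z within {x..y}) (\<lambda>\<tau>. ker_ext \<tau> u)"
      proof (cases "z = 0")
        case True
        then have "x = 0" using z that by auto
        have "((\<lambda>\<tau>. ker_ext \<tau> u) \<longlongrightarrow> (max 0 u)\<^sup>2) (at_right 0)"
          by (rule Lim_transform_eventually[OF ker_at_0[of u]])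
            (rule eventually_mono[OF eventually_at_right_less], simp add: ker_ext_def)
        then show ?thesis
          using True \<open>x = 0\<close> that by (simp add: continuous_within at_within_Icc_at_right ker_ext_def)
      next
        case False
        then have "z > 0" using z that by auto
        then show ?thesis by (rule continuous_at_imp_continuous_at_within[OF DERIV_isCont[OF d]])
      qed
    qed
    moreover have "(\<lambda>\<tau>. ker_ext \<tau> u) differentiable (at z)" if "x < z" for z
      using d[of z] that \<open>0 \<le> x\<close> real_differentiable_def by fastforce
    ultimately obtain l \<xi> where \<xi>: "x < \<xi>" "((\<lambda>\<tau>. ker_ext \<tau> u) has_real_derivative l) (at \<xi>)"
      "ker_ext y u - ker_ext x u = (y - x) * l"
      using MVT[of x y "\<lambda>\<tau>. ker_ext \<tau> u"] \<open>x < y\<close> by blast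
    then have "l = ker_uu \<xi> u / 2"
      using DERIV_unique[OF _ d[of \<xi>]] \<open>0 \<le> x\<close> by simp
    moreover have "\<bar>ker_uu \<xi> u / 2\<bar> \<le> 1" using ker_uu_bound[of \<xi> u] by auto
    ultimately show ?thesis using that \<xi>(3) by (auto simp: abs_mult intro!: mult_left_le)
  qed
  show ?thesis
  proof (cases "\<tau>1 \<ge> 0")
    case True
    then show ?thesis using pos assms by blast
  next
    case False
    show ?thesis
    proof (cases "\<tau>2 > 0")
      case True
      then show ?thesis using pos[of 0 \<tau>2] False by (auto simp: ker_ext_def)
    next
      case neg: False
      then show ?thesis using assms False by (auto simp: ker_ext_def)
    qed
  qed
qed

lemma ker_ext_lipschitz: "\<bar>ker_ext \<tau>2 u - ker_ext \<tau>1 u\<bar> \<le> \<bar>\<tau>2 - \<tau>1\<bar>"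
  using ker_ext_mono_lipschitz[of \<tau>1 \<tau>2 u] ker_ext_mono_lipschitz[of \<tau>2 \<tau>1 u]
  by (cases \<tau>1 \<tau>2 rule: linorder_cases) auto

section \<open>Integrals depending on a parameter\<close>

text \<open>Difference quotients are dominated by \<open>B\<close>, so dominated convergence along
  sequences suffices. The Lipschitz bound is required only against the base point \<open>t\<close>,
  and the derivative only for almost every \<open>s\<close>, which leaves room for the corner at
  \<open>s = t\<close>; the set \<open>S\<close> allows one-sided derivatives.\<close>

lemma has_real_derivative_integral:
  fixes F :: "real \<Rightarrow> 'a \<Rightarrow> real"
  assumes "t \<in> S" and int: "\<And>x. x \<in> S \<Longrightarrow> integrable M (F x)"
    and B: "integrable M B"
    and lip: "\<And>x. x \<in> S \<Longrightarrow> AE s in M. \<bar>F x s - F t s\<bar> \<le> B s * \<bar>x - t\<bar>"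
    and D: "AE s in M. ((\<lambda>x. F x s) has_real_derivative D s) (at t within S)"
    and [measurable]: "D \<in> borel_measurable M"
  shows "((\<lambda>x. \<integral>s. F x s \<partial>M) has_real_derivative (\<integral>s. D s \<partial>M)) (at t within S)"
  unfolding has_field_derivative_iff tendsto_at_iff_sequentially
proof (intro allI impI)
  fix X :: "nat \<Rightarrow> real"
  assume X: "\<forall>i. X i \<in> S - {t}" "X \<longlonglongrightarrow> t"
  have [measurable]: "F (X i) \<in> borel_measurable M" "F t \<in> borel_measurable M" for i
    using X int \<open>t \<in> S\<close> by auto
  have "(\<lambda>i. \<integral>s. (F (X i) s - F t s) / (X i - t) \<partial>M) \<longlonglongrightarrow> (\<integral>s. D s \<partial>M)"
  proof (rule integral_dominated_convergence[where w=B])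
    show "AE s in M. (\<lambda>i. (F (X i) s - F t s) / (X i - t)) \<longlonglongrightarrow> D s"
      using D
    proof eventually_elim
      case (elim s)
      then show ?case
        using X unfolding has_field_derivative_iff tendsto_at_iff_sequentially by (auto simp: o_def)
    qed
    show "AE s in M. norm ((F (X i) s - F t s) / (X i - t)) \<le> B s" for i
    proof -
      have "X i \<in> S" "X i \<noteq> t" using X by auto
      show ?thesis using lip[OF \<open>X i \<in> S\<close>]
        by eventually_elim (use \<open>X i \<noteq> t\<close> in \<open>simp add: divide_le_eq\<close>)
    qed
  qed (use B in auto)
  moreover have "(\<integral>s. (F (X i) s - F t s) / (X i - t) \<partial>M)
      = ((\<integral>s. F (X i) s \<partial>M) - (\<integral>s. F t s \<partial>M)) / (X i - t)" for i
    using int X \<open>t \<in> S\<close> by simp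
  ultimately show "((\<lambda>y. ((\<integral>s. F y s \<partial>M) - (\<integral>s. F t s \<partial>M)) / (y - t)) \<circ> X) \<longlonglongrightarrow> (\<integral>s. D s \<partial>M)"
    by (simp only: o_def)
qed

text \<open>The open set \<open>U\<close> localises the domination: the heat integrands are bounded
  only for bounded \<open>x\<close>.\<close>

lemma continuous_within_integral:
  fixes F :: "'b::{first_countable_topology,t2_space} \<Rightarrow> 'a \<Rightarrow> real"
  assumes "z \<in> S" "open U" "z \<in> U"
    and meas: "\<And>x. x \<in> S \<Longrightarrow> F x \<in> borel_measurable M"
    and B: "integrable M B"
    and bd: "\<And>x. x \<in> S \<inter> U \<Longrightarrow> AE s in M. \<bar>F x s\<bar> \<le> B s"
    and cont: "AE s in M. continuous (at z within S) (\<lambda>x. F x s)"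
  shows "continuous (at z within S) (\<lambda>x. \<integral>s. F x s \<partial>M)"
proof -
  have "continuous (at z within S \<inter> U) (\<lambda>x. \<integral>s. F x s \<partial>M)"
    unfolding continuous_within tendsto_at_iff_sequentially
  proof (intro allI impI)
    fix X :: "nat \<Rightarrow> 'b"
    assume X: "\<forall>i. X i \<in> S \<inter> U - {z}" "X \<longlonglongrightarrow> z"
    have "(\<lambda>i. \<integral>s. F (X i) s \<partial>M) \<longlonglongrightarrow> (\<integral>s. F z s \<partial>M)"
    proof (rule integral_dominated_convergence[where w=B])
      show "AE s in M. (\<lambda>i. F (X i) s) \<longlonglongrightarrow> F z s"
        using cont
      proof eventually_elim
        case (elim s)
        then show ?case
          using X unfolding continuous_within tendsto_at_iff_sequentially by (auto simp: o_def)
      qed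
    qed (use B meas bd X \<open>z \<in> S\<close> in auto)
    then show "((\<lambda>x. \<integral>s. F x s \<partial>M) \<circ> X) \<longlonglongrightarrow> (\<integral>s. F z s \<partial>M)"
      by (simp add: o_def)
  qed
  moreover have "at z within S \<inter> U = at z within S"
    using assms by (intro at_within_nhd[of z U]) auto
  ultimately show ?thesis by simp
qed

section \<open>Duhamel's formula\<close>

text \<open>These three properties are what measurability, domination and pointwise convergence of
  the Duhamel integrands require; one set of proofs then serves \<open>ker\<close>,
  \<open>ker_u\<close> and \<open>ker_uu\<close>. The bound must be uniform as \<open>\<tau>\<close>
  tends to 0, while continuity is asked only for \<open>\<tau> > 0\<close>.\<close>

definition regular_kernel :: "(real \<Rightarrow> real \<Rightarrow> real) \<Rightarrow> bool" where
  "regular_kernel P \<longleftrightarrow>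
     (\<forall>f\<in>borel_measurable borel. \<forall>g\<in>borel_measurable borel. (\<lambda>s::real. P (f s) (g s)) \<in> borel_measurable borel) \<and>
     (\<forall>R. \<exists>M. \<forall>\<tau> u. 0 < \<tau> \<longrightarrow> \<tau> \<le> R \<longrightarrow> \<bar>u\<bar> \<le> R \<longrightarrow> \<bar>P \<tau> u\<bar> \<le> M) \<and>
     (\<forall>\<tau> u. 0 < \<tau> \<longrightarrow> isCont (\<lambda>p. P (fst p) (snd p)) (\<tau>, u))"

lemma isCont_phi: "isCont phi x"
  using DERIV_phi DERIV_isCont by blast

lemma regular_ker: "regular_kernel ker"
  unfolding regular_kernel_def
proof (intro conjI allI ballI impI)
  fix R :: real
  have "\<bar>ker \<tau> u\<bar> \<le> 2 * (R\<^sup>2 + R)" if "0 < \<tau>" "\<tau> \<le> R" "\<bar>u\<bar> \<le> R" for \<tau> u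
  proof -
    have "u\<^sup>2 \<le> R\<^sup>2" using that by (simp add: abs_le_square_iff[symmetric])
    then show ?thesis using ker_bound[of \<tau> u] that by auto
  qed
  then show "\<exists>M. \<forall>\<tau> u. 0 < \<tau> \<longrightarrow> \<tau> \<le> R \<longrightarrow> \<bar>u\<bar> \<le> R \<longrightarrow> \<bar>ker \<tau> u\<bar> \<le> M"
    by blast
next
  fix \<tau> u :: real assume "0 < \<tau>"
  then show "isCont (\<lambda>p. ker (fst p) (snd p)) (\<tau>, u)"
    unfolding ker_def
    by (intro continuous_intros isCont_o2[OF _ isCont_Phi] isCont_o2[OF _ isCont_phi]) auto
qed measurable

lemma regular_ker_u: "regular_kernel ker_u"
  unfolding regular_kernel_def
proof (intro conjI allI ballI impI)
  fix R :: real
  have "\<bar>ker_u \<tau> u\<bar> \<le> 2 * (R + sqrt R)" if "0 < \<tau>" "\<tau> \<le> R" "\<bar>u\<bar> \<le> R" for \<tau> u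
  proof -
    have "\<bar>ker_u \<tau> u\<bar> \<le> 2 * (\<bar>u\<bar> + sqrt \<tau>)" using ker_u_bound that by simp
    also have "\<dots> \<le> 2 * (R + sqrt R)"
      using that by (intro mult_left_mono add_mono) auto
    finally show ?thesis .
  qed
  then show "\<exists>M. \<forall>\<tau> u. 0 < \<tau> \<longrightarrow> \<tau> \<le> R \<longrightarrow> \<bar>u\<bar> \<le> R \<longrightarrow> \<bar>ker_u \<tau> u\<bar> \<le> M"
    by blast
next
  fix \<tau> u :: real assume "0 < \<tau>"
  then show "isCont (\<lambda>p. ker_u (fst p) (snd p)) (\<tau>, u)"
    unfolding ker_u_def
    by (intro continuous_intros isCont_o2[OF _ isCont_Phi] isCont_o2[OF _ isCont_phi]) auto
qed measurable

lemma regular_ker_uu: "regular_kernel ker_uu"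
  unfolding regular_kernel_def
proof (intro conjI allI ballI impI)
  fix \<tau> u :: real assume "0 < \<tau>"
  then show "isCont (\<lambda>p. ker_uu (fst p) (snd p)) (\<tau>, u)"
    unfolding ker_uu_def
    by (intro continuous_intros isCont_o2[OF _ isCont_Phi]) auto
next
  show "\<exists>M. \<forall>\<tau> u. 0 < \<tau> \<longrightarrow> \<tau> \<le> R \<longrightarrow> \<bar>u\<bar> \<le> R \<longrightarrow> \<bar>ker_uu \<tau> u\<bar> \<le> M" for R
    by (rule exI[of _ 2]) (simp add: ker_uu_bound)
qed measurable

text \<open>The setting is \<open>F_t + (k / 2) * F_xx = w(t) * (max 0 (x - b(t)))^2\<close> with
  terminal value 0, whose solution is minus the Duhamel integral of \<open>ker\<close>;
  \<open>k * (s - t)\<close> is the variance accumulated between \<open>t\<close> and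
  \<open>s\<close>.\<close>

locale heat_source =
  fixes T k :: real and w b :: "real \<Rightarrow> real"
  assumes T: "0 < T" and k: "0 < k"
    and w_cont: "continuous_on {0..T} w" and b_cont: "continuous_on {0..T} b"
    and w_meas [measurable]: "w \<in> borel_measurable borel"
    and b_meas [measurable]: "b \<in> borel_measurable borel"
begin

text \<open>The interval is open at \<open>t\<close>, so only values of \<open>P\<close> at positive
  elapsed time count.\<close>

definition duhamel :: "(real \<Rightarrow> real \<Rightarrow> real) \<Rightarrow> real \<Rightarrow> real \<Rightarrow> real" where
  "duhamel P t x = (\<integral>s. indicator {t<..T} s * (w s * P (k * (s - t)) (x - b s)) \<partial>lborel)"

lemma coeff_bound: obtains W where "0 < W" "\<And>s. s \<in> {0..T} \<Longrightarrow> \<bar>w s\<bar> \<le> W" "\<And>s. s \<in> {0..T} \<Longrightarrow> \<bar>b s\<bar> \<le> W"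
proof -
  have "bounded (w ` {0..T})" "bounded (b ` {0..T})"
    using w_cont b_cont by (auto intro!: compact_imp_bounded compact_continuous_image)
  then obtain A B where "\<forall>s\<in>{0..T}. \<bar>w s\<bar> \<le> A" "\<forall>s\<in>{0..T}. \<bar>b s\<bar> \<le> B"
    unfolding bounded_iff by auto
  then show ?thesis
    by (intro that[of "\<bar>A\<bar> + \<bar>B\<bar> + 1"]) force+
qed

text \<open>The bound \<open>M\<close> depends on \<open>R\<close> but not on \<open>t\<close>, so a
  single integrable function dominates also while the lower limit moves.\<close>

lemma integrand_bound:
  assumes "regular_kernel P"
  obtains M where "\<And>t x s. t \<in> {0..T} \<Longrightarrow> \<bar>x\<bar> \<le> R \<Longrightarrow>
    \<bar>indicator {t<..T} s * (w s * P (k * (s - t)) (x - b s))\<bar> \<le> indicator {0..T} s * M"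
proof -
  obtain W where W: "0 < W" "\<And>s. s \<in> {0..T} \<Longrightarrow> \<bar>w s\<bar> \<le> W" "\<And>s. s \<in> {0..T} \<Longrightarrow> \<bar>b s\<bar> \<le> W"
    using coeff_bound by blast
  \<comment> \<open>The radius \<open>k * T + \<bar>R\<bar> + W\<close> bounds both arguments: the
    elapsed variance by \<open>k * T\<close>, the shifted position by
    \<open>\<bar>R\<bar> + W\<close>.\<close>
  obtain M where M: "\<And>\<tau> u. 0 < \<tau> \<Longrightarrow> \<tau> \<le> k * T + \<bar>R\<bar> + W \<Longrightarrow> \<bar>u\<bar> \<le> k * T + \<bar>R\<bar> + W \<Longrightarrow> \<bar>P \<tau> u\<bar> \<le> M"
    using assms unfolding regular_kernel_def by meson
  have "\<bar>indicator {t<..T} s * (w s * P (k * (s - t)) (x - b s))\<bar> \<le> indicator {0..T} s * (W * M)"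
    if "t \<in> {0..T}" "\<bar>x\<bar> \<le> R" for t x s
  proof (cases "t < s \<and> s \<le> T")
    case True
    then have s: "s \<in> {0..T}" "0 < k * (s - t)" using that k by auto
    have "k * (s - t) \<le> k * T" using True that k by (intro mult_left_mono) auto
    then have "k * (s - t) \<le> k * T + \<bar>R\<bar> + W" using W(1) by linarith
    moreover have "\<bar>x - b s\<bar> \<le> k * T + \<bar>R\<bar> + W"
      using W(3)[OF s(1)] that mult_pos_pos[OF k T] by linarith
    ultimately have "\<bar>P (k * (s - t)) (x - b s)\<bar> \<le> M"
      using M s by blast
    then have "\<bar>w s\<bar> * \<bar>P (k * (s - t)) (x - b s)\<bar> \<le> W * M"
      using W(1) W(2)[OF s(1)] by (intro mult_mono) auto
    then show ?thesis using s True by (simp add: abs_mult)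
  next
    case False
    \<comment> \<open>Off the interval the left side is 0; evaluating the kernel bound at one
      admissible point shows that \<open>M\<close> is nonnegative.\<close>
    have "0 \<le> M" using M[of "k * T" 0] k T W(1) by force
    then show ?thesis using False W(1) by (auto simp: indicator_def)
  qed
  then show ?thesis by (rule that)
qed

lemma integrand_measurable:
  assumes "regular_kernel P"
  shows "(\<lambda>s. indicator {t<..T} s * (w s * P (k * (s - t)) (x - b s))) \<in> borel_measurable lborel"
proof -
  have "\<forall>f\<in>borel_measurable borel. \<forall>g\<in>borel_measurable borel.
      (\<lambda>s::real. P (f s) (g s)) \<in> borel_measurable borel"
    using assms unfolding regular_kernel_def by blast
  then have "\<forall>g\<in>borel_measurable borel. (\<lambda>s::real. P (k * (s - t)) (g s)) \<in> borel_measurable borel"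
    by (rule bspec) measurable
  then have [measurable]: "(\<lambda>s. P (k * (s - t)) (x - b s)) \<in> borel_measurable borel"
    by (rule bspec) measurable
  show ?thesis by measurable
qed

lemma integrable_dominator: "integrable lborel (\<lambda>s. indicator {0..T} s * (M::real))"
  using T by (intro integrable_mult_left integrable_real_indicator) simp_all

lemma integrand_integrable:
  assumes "regular_kernel P" "t \<in> {0..T}"
  shows "integrable lborel (\<lambda>s. indicator {t<..T} s * (w s * P (k * (s - t)) (x - b s)))"
proof -
  obtain M where M: "\<And>t' x' s. t' \<in> {0..T} \<Longrightarrow> \<bar>x'\<bar> \<le> \<bar>x\<bar> \<Longrightarrow>
    \<bar>indicator {t'<..T} s * (w s * P (k * (s - t')) (x' - b s))\<bar> \<le> indicator {0..T} s * M"
    using integrand_bound[OF assms(1), of "\<bar>x\<bar>"] by blast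
  show ?thesis
  proof (rule Bochner_Integration.integrable_bound[OF integrable_dominator[of M] integrand_measurable[OF assms(1)]])
    show "AE s in lborel. norm (indicator {t<..T} s * (w s * P (k * (s - t)) (x - b s)))
        \<le> norm (indicator {0..T} s * M)"
      using M[OF assms(2) order_refl] by (intro AE_I2) (smt (verit) real_norm_def)
  qed
qed

text \<open>For fixed \<open>s\<close>, the integrand is continuous at \<open>(t0, x0)\<close>
  unless \<open>s = t0\<close>: for \<open>t0 < s \<le> T\<close> the indicator is locally 1 and
  \<open>P\<close> is continuous at a positive time, otherwise it is locally 0. The exception is a
  null set.\<close>

lemma continuous_on_duhamel:
  assumes "regular_kernel P"
  shows "continuous_on ({0..T} \<times> UNIV) (\<lambda>p. duhamel P (fst p) (snd p))"
  unfolding continuous_on_eq_continuous_within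
proof
  fix z :: "real \<times> real" assume z: "z \<in> {0..T} \<times> UNIV"
  obtain t0 x0 where z_eq: "z = (t0, x0)" by (cases z)
  define U where "U = {p::real\<times>real. \<bar>snd p\<bar> < \<bar>x0\<bar> + 1}"
  have "open U" unfolding U_def by (intro open_Collect_less continuous_intros)
  obtain M where M: "\<And>t x s. t \<in> {0..T} \<Longrightarrow> \<bar>x\<bar> \<le> \<bar>x0\<bar> + 1 \<Longrightarrow>
    \<bar>indicator {t<..T} s * (w s * P (k * (s - t)) (x - b s))\<bar> \<le> indicator {0..T} s * M"
    using integrand_bound[OF assms(1), of "\<bar>x0\<bar> + 1"] by blast
  show "continuous (at z within {0..T} \<times> UNIV) (\<lambda>p. duhamel P (fst p) (snd p))"
    unfolding duhamel_def
  proof (rule continuous_within_integral[OF z \<open>open U\<close> _ _ integrable_dominator[of M]])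
    show "z \<in> U" by (simp add: U_def z_eq)
    show "AE s in lborel. \<bar>indicator {fst p<..T} s * (w s * P (k * (s - fst p)) (snd p - b s))\<bar>
        \<le> indicator {0..T} s * M" if "p \<in> ({0..T} \<times> UNIV) \<inter> U" for p
      using that by (intro AE_I2 M) (auto simp: U_def)
    show "AE s in lborel. continuous (at z within {0..T} \<times> UNIV)
        (\<lambda>p. indicator {fst p<..T} s * (w s * P (k * (s - fst p)) (snd p - b s)))"
      using AE_lborel_singleton[of t0]
    proof eventually_elim
      case (elim s)
      show ?case
      proof (cases "t0 < s \<and> s \<le> T")
        case True
        have ev: "\<forall>\<^sub>F p in at z within {0..T} \<times> UNIV. fst p < s"
          using True by (intro order_tendstoD(2)[OF tendsto_fst[OF tendsto_ident_at]]) (simp add: z_eq)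
        have "((\<lambda>p. P (fst (k * (s - fst p), snd p - b s)) (snd (k * (s - fst p), snd p - b s)))
            \<longlongrightarrow> P (fst (k * (s - t0), x0 - b s)) (snd (k * (s - t0), x0 - b s)))
            (at z within {0..T} \<times> UNIV)"
        proof (rule isCont_tendsto_compose[where g="\<lambda>p. P (fst p) (snd p)"])
          show "isCont (\<lambda>p. P (fst p) (snd p)) (k * (s - t0), x0 - b s)"
            using assms True k unfolding regular_kernel_def by simp
          show "((\<lambda>p. (k * (s - fst p), snd p - b s)) \<longlongrightarrow> (k * (s - t0), x0 - b s))
              (at z within {0..T} \<times> UNIV)"
            by (auto intro!: tendsto_eq_intros simp: z_eq)
        qed
        then have "((\<lambda>p. w s * P (k * (s - fst p)) (snd p - b s))
            \<longlongrightarrow> w s * P (k * (s - t0)) (x0 - b s)) (at z within {0..T} \<times> UNIV)"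
          by (intro tendsto_mult tendsto_const) simp
        then have "((\<lambda>p. indicator {fst p<..T} s * (w s * P (k * (s - fst p)) (snd p - b s)))
            \<longlongrightarrow> w s * P (k * (s - t0)) (x0 - b s)) (at z within {0..T} \<times> UNIV)"
          by (rule Lim_transform_eventually) (rule eventually_mono[OF ev], use True in simp)
        then show ?thesis using True by (simp add: continuous_within z_eq)
      next
        case False
        have "\<forall>\<^sub>F p in at z within {0..T} \<times> UNIV. indicator {fst p<..T} s = (0::real)"
        proof (cases "s \<le> T")
          case le: True
          then have "s < t0" using False elim by auto
          then have "\<forall>\<^sub>F p in at z within {0..T} \<times> UNIV. s < fst p"
            by (intro order_tendstoD(1)[OF tendsto_fst[OF tendsto_ident_at]]) (simp add: z_eq)
          then show ?thesis by (auto elim!: eventually_mono)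
        qed auto
        then have "((\<lambda>p. indicator {fst p<..T} s * (w s * P (k * (s - fst p)) (snd p - b s)))
            \<longlongrightarrow> 0) (at z within {0..T} \<times> UNIV)"
          by (intro tendsto_eventually) (auto elim!: eventually_mono)
        then show ?thesis using False by (simp add: continuous_within z_eq)
      qed
    qed
  qed (use integrand_measurable[OF assms] in auto)
qed

text \<open>The bound on \<open>P'\<close> over the unit ball around \<open>x\<close> is, by the
  mean value inequality, a Lipschitz bound for the integrand, hence a dominating function for its
  difference quotients.\<close>

lemma DERIV_duhamel:
  assumes P: "regular_kernel P" and P': "regular_kernel P'"
    and d: "\<And>\<tau> u. 0 < \<tau> \<Longrightarrow> ((\<lambda>u. P \<tau> u) has_real_derivative P' \<tau> u) (at u)"
    and t: "t \<in> {0..T}"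
  shows "((\<lambda>x. duhamel P t x) has_real_derivative duhamel P' t x) (at x)"
proof -
  obtain M where M: "\<And>t x' s. t \<in> {0..T} \<Longrightarrow> \<bar>x'\<bar> \<le> \<bar>x\<bar> + 1 \<Longrightarrow>
    \<bar>indicator {t<..T} s * (w s * P' (k * (s - t)) (x' - b s))\<bar> \<le> indicator {0..T} s * M"
    using integrand_bound[OF P', of "\<bar>x\<bar> + 1"] by blast
  have deriv: "((\<lambda>x. indicator {t<..T} s * (w s * P (k * (s - t)) (x - b s))) has_real_derivative
      indicator {t<..T} s * (w s * P' (k * (s - t)) (x' - b s))) (at x' within X)" for s x' X
  proof (cases "t < s")
    case True
    then have "0 < k * (s - t)" using k by simp
    note DERIV_chain2[OF d[OF this], derivative_intros]
    show ?thesis by (auto intro!: derivative_eq_intros)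
  qed simp
  have "((\<lambda>x. duhamel P t x) has_real_derivative duhamel P' t x) (at x within ball x 1)"
    unfolding duhamel_def
  proof (rule has_real_derivative_integral[OF _ _ integrable_dominator[of M]])
    show "AE s in lborel. \<bar>indicator {t<..T} s * (w s * P (k * (s - t)) (y - b s))
        - indicator {t<..T} s * (w s * P (k * (s - t)) (x - b s))\<bar>
        \<le> indicator {0..T} s * M * \<bar>y - x\<bar>" if "y \<in> ball x 1" for y
    proof (rule AE_I2)
      fix s
      have "norm (indicator {t<..T} s * (w s * P (k * (s - t)) (y - b s))
        - indicator {t<..T} s * (w s * P (k * (s - t)) (x - b s)))
        \<le> indicator {0..T} s * M * norm (y - x)"
      proof (rule field_differentiable_bound[OF _ deriv])
        show "norm (indicator {t<..T} s * (w s * P' (k * (s - t)) (z - b s))) \<le> indicator {0..T} s * M"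
          if "z \<in> ball x 1" for z
          using that M[OF t, of z s] by (auto simp: dist_real_def)
      qed (use that in auto)
      then show "\<bar>indicator {t<..T} s * (w s * P (k * (s - t)) (y - b s))
        - indicator {t<..T} s * (w s * P (k * (s - t)) (x - b s))\<bar>
        \<le> indicator {0..T} s * M * \<bar>y - x\<bar>" by simp
    qed
  next
    show "x \<in> ball x 1" by simp
    show "integrable lborel (\<lambda>s. indicator {t<..T} s * (w s * P (k * (s - t)) (y - b s)))" for y
      by (rule integrand_integrable[OF P t])
    show "(\<lambda>s. indicator {t<..T} s * (w s * P' (k * (s - t)) (x - b s))) \<in> borel_measurable lborel"
      by (rule integrand_measurable[OF P'])
    show "AE s in lborel. ((\<lambda>x. indicator {t<..T} s * (w s * P (k * (s - t)) (x - b s))) has_real_derivative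
      indicator {t<..T} s * (w s * P' (k * (s - t)) (x - b s))) (at x within ball x 1)"
      by (intro AE_I2 deriv)
  qed
  moreover have "at x within ball x 1 = at x" by (rule at_within_open) auto
  ultimately show ?thesis by simp
qed

text \<open>Extending the integrand to \<open>s < t\<close> by the initial datum, which does not depend on \<open>t\<close>, turns
  the integral into one over the fixed interval \<open>{0..T}\<close> minus an ordinary antiderivative in \<open>t\<close>. The
  extended integrand is Lipschitz in \<open>t\<close>.\<close>

lemma DERIV_duhamel_time:
  assumes t: "t \<in> {0..<T}"
  shows "((\<lambda>t. duhamel ker t x) has_real_derivative
     - (k / 2) * duhamel ker_uu t x - w t * (max 0 (x - b t))\<^sup>2) (at t within {0..<T})"
proof -
  define q where "q s = w s * (max 0 (x - b s))\<^sup>2" for s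
  define E where "E t s = indicator {0..T} s * (w s * ker_ext (k * (s - t)) (x - b s))" for t s
  obtain W where W: "0 < W" "\<And>s. s \<in> {0..T} \<Longrightarrow> \<bar>w s\<bar> \<le> W" "\<And>s. s \<in> {0..T} \<Longrightarrow> \<bar>b s\<bar> \<le> W"
    using coeff_bound by blast
  have q_cont: "continuous_on {0..T} q"
    unfolding q_def by (intro continuous_intros w_cont b_cont)
  have q_int: "set_integrable lborel {0..t} q" if "t \<in> {0..T}" for t
    using that by (intro borel_integrable_atLeastAtMost' continuous_on_subset[OF q_cont]) auto
  \<comment> \<open>At \<open>s = t\<close> the elapsed time is 0 and \<open>ker_ext\<close> takes
    the datum, so \<open>s = t\<close> falls into the closed interval \<open>{0..t}\<close>,
    complementary to \<open>{t<..T}\<close>.\<close>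
  have E_eq: "E t s = indicator {t<..T} s * (w s * ker (k * (s - t)) (x - b s))
      + indicator {0..t} s * q s" if "t \<in> {0..T}" for t s
    using that k by (auto simp: E_def q_def ker_ext_def indicator_def zero_less_mult_iff)
  have E_int: "integrable lborel (E t)" if "t \<in> {0..T}" for t
    unfolding E_eq[OF that, abs_def]
    using q_int[OF that] by (intro Bochner_Integration.integrable_add integrand_integrable regular_ker that)
      (simp add: set_integrable_def)
  have split: "duhamel ker t x = (\<integral>s. E t s \<partial>lborel) - integral {0..t} q" if "t \<in> {0..T}" for t
  proof -
    have "(\<integral>s. E t s \<partial>lborel) = duhamel ker t x + (LINT s:{0..t}|lborel. q s)"
      unfolding E_eq[OF that] duhamel_def set_lebesgue_integral_def
      using q_int[OF that] integrand_integrable[OF regular_ker that, of x]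
      by (subst Bochner_Integration.integral_add) (auto simp: set_integrable_def)
    then show ?thesis
      using set_borel_integral_eq_integral(2)[OF q_int[OF that]] by simp
  qed
  \<comment> \<open>For \<open>s > t\<close> the chain rule contributes \<open>- k\<close> times
    \<open>ker_uu / 2\<close>; for \<open>s < t\<close> the extended integrand does not depend on
    \<open>t\<close>.\<close>
  let ?D = "\<lambda>s. - (k / 2) * (indicator {t<..T} s * (w s * ker_uu (k * (s - t)) (x - b s)))"
  have "((\<lambda>t. \<integral>s. E t s \<partial>lborel) has_real_derivative (\<integral>s. ?D s \<partial>lborel)) (at t within {0..<T})"
  proof (rule has_real_derivative_integral[OF t _ integrable_dominator[of "W * k"]])
    show "AE s in lborel. \<bar>E y s - E t s\<bar> \<le> indicator {0..T} s * (W * k) * \<bar>y - t\<bar>"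
      if "y \<in> {0..<T}" for y
    proof (rule AE_I2)
      fix s
      have "\<bar>w s\<bar> * \<bar>ker_ext (k * (s - y)) (x - b s) - ker_ext (k * (s - t)) (x - b s)\<bar>
          \<le> W * (k * \<bar>y - t\<bar>)" if "s \<in> {0..T}"
      proof (rule mult_mono)
        have "\<bar>k * (s - y) - k * (s - t)\<bar> = k * \<bar>y - t\<bar>"
          using k by (simp add: right_diff_distrib[symmetric] abs_mult)
        then show "\<bar>ker_ext (k * (s - y)) (x - b s) - ker_ext (k * (s - t)) (x - b s)\<bar> \<le> k * \<bar>y - t\<bar>"
          using ker_ext_lipschitz[of "k * (s - y)" "x - b s" "k * (s - t)"] by simp
      qed (use W that in auto)
      then show "\<bar>E y s - E t s\<bar> \<le> indicator {0..T} s * (W * k) * \<bar>y - t\<bar>"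
        unfolding E_def by (auto simp: indicator_def abs_mult right_diff_distrib[symmetric] mult.assoc)
    qed
    show "AE s in lborel. ((\<lambda>t. E t s) has_real_derivative ?D s) (at t within {0..<T})"
      using AE_lborel_singleton[of t]
    proof eventually_elim
      case (elim s)
      then have "k * (s - t) \<noteq> 0" using k by auto
      then have "((\<lambda>\<tau>. ker_ext \<tau> (x - b s)) has_real_derivative
          (if 0 < k * (s - t) then ker_uu (k * (s - t)) (x - b s) / 2 else 0)) (at (k * (s - t)))"
        by (rule DERIV_ker_ext)
      moreover have "((\<lambda>t. k * (s - t)) has_real_derivative - k) (at t within {0..<T})"
        by (auto intro!: derivative_eq_intros)
      ultimately have "((\<lambda>t. ker_ext (k * (s - t)) (x - b s)) has_real_derivative
          (if 0 < k * (s - t) then ker_uu (k * (s - t)) (x - b s) / 2 else 0) * - k) (at t within {0..<T})"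
        by (rule DERIV_chain2)
      then have "((\<lambda>t. E t s) has_real_derivative indicator {0..T} s * (w s *
          ((if 0 < k * (s - t) then ker_uu (k * (s - t)) (x - b s) / 2 else 0) * - k))) (at t within {0..<T})"
        unfolding E_def by (intro DERIV_cmult)
      also have "indicator {0..T} s * (w s *
          ((if 0 < k * (s - t) then ker_uu (k * (s - t)) (x - b s) / 2 else 0) * - k)) = ?D s"
        using k t elim by (auto simp: indicator_def zero_less_mult_iff)
      finally show ?case .
    qed
    show "?D \<in> borel_measurable lborel"
      by (intro borel_measurable_times borel_measurable_const integrand_measurable regular_ker_uu)
  qed (use E_int in auto)
  moreover have "(\<integral>s. ?D s \<partial>lborel) = - (k / 2) * duhamel ker_uu t x"
    unfolding duhamel_def by (rule integral_mult_right_zero)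
  moreover have "((\<lambda>t. integral {0..t} q) has_real_derivative q t) (at t within {0..<T})"
    by (rule DERIV_subset[OF integral_has_real_derivative[OF q_cont]]) (use t in auto)
  ultimately have "((\<lambda>t. (\<integral>s. E t s \<partial>lborel) - integral {0..t} q) has_real_derivative
      - (k / 2) * duhamel ker_uu t x - q t) (at t within {0..<T})"
    by (auto intro!: derivative_intros)
  then show ?thesis
    unfolding q_def[symmetric]
    by (rule has_field_derivative_transform_within[where d=1]) (use t split in auto)
qed

text \<open>Since \<open>b\<close> is bounded by \<open>W\<close>, the kernel bounds at
  \<open>u = x - b s\<close> become bounds in \<open>\<bar>x\<bar> + W\<close>, and integration
  costs only the factors \<open>T\<close> and \<open>W\<close>.\<close>

lemma duhamel_bound:
  obtains C where "0 < C" "\<And>t x. t \<in> {0..T} \<Longrightarrow> \<bar>duhamel ker t x\<bar> \<le> C * (1 + x\<^sup>2)"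
    "\<And>t x. t \<in> {0..T} \<Longrightarrow> \<bar>duhamel ker_u t x\<bar> \<le> C * (1 + \<bar>x\<bar>)"
proof -
  obtain W where W: "0 < W" "\<And>s. s \<in> {0..T} \<Longrightarrow> \<bar>w s\<bar> \<le> W" "\<And>s. s \<in> {0..T} \<Longrightarrow> \<bar>b s\<bar> \<le> W"
    using coeff_bound by blast
  have *: "\<bar>duhamel P t x\<bar> \<le> T * (W * M)"
    if t: "t \<in> {0..T}" and P: "regular_kernel P"
      and M: "\<And>\<tau> u. 0 < \<tau> \<Longrightarrow> \<tau> \<le> k * T \<Longrightarrow> \<bar>u\<bar> \<le> \<bar>x\<bar> + W \<Longrightarrow> \<bar>P \<tau> u\<bar> \<le> M" "0 \<le> M"
    for P t x M
  proof -
    have le: "\<bar>indicator {t<..T} s * (w s * P (k * (s - t)) (x - b s))\<bar> \<le> indicator {0..T} s * (W * M)" for s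
    proof (cases "t < s \<and> s \<le> T")
      case True
      then have s: "s \<in> {0..T}" "0 < k * (s - t)" using t k by auto
      have "k * (s - t) \<le> k * T" using True t k by (intro mult_left_mono) auto
      moreover have "\<bar>x - b s\<bar> \<le> \<bar>x\<bar> + W"
        using W(3)[OF s(1)] by linarith
      ultimately have "\<bar>P (k * (s - t)) (x - b s)\<bar> \<le> M"
        using M s by blast
      then have "\<bar>w s\<bar> * \<bar>P (k * (s - t)) (x - b s)\<bar> \<le> W * M"
        using W(1) W(2)[OF s(1)] by (intro mult_mono) auto
      then show ?thesis using s True by (simp add: abs_mult)
    next
      case False
      then show ?thesis using \<open>0 \<le> M\<close> W(1) by (auto simp: indicator_def)
    qed
    have "\<bar>duhamel P t x\<bar> \<le> (\<integral>s. indicator {0..T} s * (W * M) \<partial>lborel)"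
      unfolding duhamel_def
      by (rule integral_abs_bound[THEN order_trans, OF integral_mono])
        (use integrand_integrable[OF P t] integrable_dominator le in auto)
    then show ?thesis using T by simp
  qed
  \<comment> \<open>One constant for both estimates: \<open>2 * (u^2 + \<tau>)\<close> is at most
    \<open>4 * x^2 + 4 * W^2 + 2 * k * T\<close>, and
    \<open>2 * (\<bar>u\<bar> + sqrt \<tau>)\<close> at most
    \<open>2 * \<bar>x\<bar> + 2 * W + 2 * sqrt (k * T)\<close>.\<close>
  define A where "A = 4 + 4 * W\<^sup>2 + 2 * k * T + 2 * W + 2 * sqrt (k * T)"
  have kT: "0 < k * T" using k T by simp
  have A: "0 < A" unfolding A_def using W(1) kT k T by (intro add_pos_nonneg) auto
  show ?thesis
  proof
    show "0 < T * (W * A)" using T W A by simp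
    show "\<bar>duhamel ker t x\<bar> \<le> T * (W * A) * (1 + x\<^sup>2)" if "t \<in> {0..T}" for t x
    proof -
      have "\<bar>ker \<tau> u\<bar> \<le> A * (1 + x\<^sup>2)" if "0 < \<tau>" "\<tau> \<le> k * T" "\<bar>u\<bar> \<le> \<bar>x\<bar> + W" for \<tau> u
      proof -
        have "u\<^sup>2 \<le> (\<bar>x\<bar> + W)\<^sup>2" using that W(1) by (simp add: abs_le_square_iff[symmetric])
        also have "\<dots> \<le> 2 * x\<^sup>2 + 2 * W\<^sup>2"
          using sum_squares_bound[of "\<bar>x\<bar>" W] by (simp add: power2_sum)
        finally have "\<bar>ker \<tau> u\<bar> \<le> 4 * x\<^sup>2 + (4 * W\<^sup>2 + 2 * k * T)"
          using ker_bound[of \<tau> u] that by simp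
        also have "\<dots> \<le> A * x\<^sup>2 + A"
        proof (rule add_mono)
          show "4 * x\<^sup>2 \<le> A * x\<^sup>2"
            unfolding A_def using W(1) kT k T by (intro mult_right_mono) auto
          show "4 * W\<^sup>2 + 2 * k * T \<le> A" unfolding A_def using W(1) kT k T by auto
        qed
        finally show ?thesis by (simp add: algebra_simps)
      qed
      then show ?thesis using *[OF that regular_ker, of x "A * (1 + x\<^sup>2)"] A by (simp add: mult_ac)
    qed
    show "\<bar>duhamel ker_u t x\<bar> \<le> T * (W * A) * (1 + \<bar>x\<bar>)" if "t \<in> {0..T}" for t x
    proof -
      have "\<bar>ker_u \<tau> u\<bar> \<le> A * (1 + \<bar>x\<bar>)" if "0 < \<tau>" "\<tau> \<le> k * T" "\<bar>u\<bar> \<le> \<bar>x\<bar> + W" for \<tau> u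
      proof -
        have "\<bar>ker_u \<tau> u\<bar> \<le> 2 * (\<bar>u\<bar> + sqrt \<tau>)" using ker_u_bound that by simp
        also have "\<dots> \<le> 2 * ((\<bar>x\<bar> + W) + sqrt (k * T))"
          using that by (intro mult_left_mono add_mono) auto
        also have "\<dots> = 2 * \<bar>x\<bar> + (2 * W + 2 * sqrt (k * T))" by simp
        also have "\<dots> \<le> A * \<bar>x\<bar> + A"
        proof (rule add_mono)
          have "2 \<le> A" unfolding A_def using W(1) kT real_sqrt_ge_zero[of "k * T"] zero_le_power2[of W] by linarith
          then show "2 * \<bar>x\<bar> \<le> A * \<bar>x\<bar>" by (intro mult_right_mono) auto
          show "2 * W + 2 * sqrt (k * T) \<le> A" unfolding A_def using W(1) kT k T by auto
        qed
        finally show ?thesis by (simp add: algebra_simps)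
      qed
      then show ?thesis using *[OF that regular_ker_u, of x "A * (1 + \<bar>x\<bar>)"] A by (simp add: mult_ac)
    qed
  qed
qed

end

section \<open>The maximum principle\<close>

text \<open>A chain rule without assuming joint differentiability of \<open>F\<close>. The increment
  splits into a time step at fixed position \<open>\<xi> t\<close> and a space step at time
  \<open>s\<close>; the mean value theorem writes the latter as \<open>Fx s c\<close> times the
  increment of \<open>\<xi>\<close>, and \<open>Fx s c\<close> converges by joint
  continuity.\<close>

lemma has_real_derivative_along_curve:
  fixes F :: "real \<Rightarrow> real \<Rightarrow> real"
  assumes t: "t \<in> S"
    and Ft: "((\<lambda>s. F s (\<xi> t)) has_real_derivative Dt) (at t within S)"
    and Fx: "\<And>s x. s \<in> S \<Longrightarrow> ((\<lambda>x. F s x) has_real_derivative Fx s x) (at x)"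
    and cont: "continuous (at (t, \<xi> t) within S \<times> UNIV) (\<lambda>p. Fx (fst p) (snd p))"
    and \<xi>: "(\<xi> has_real_derivative \<xi>') (at t within S)"
  shows "((\<lambda>s. F s (\<xi> s)) has_real_derivative Dt + Fx t (\<xi> t) * \<xi>') (at t within S)"
proof -
  have "\<exists>c. \<bar>c - \<xi> t\<bar> \<le> \<bar>\<xi> s - \<xi> t\<bar> \<and> F s (\<xi> s) - F s (\<xi> t) = (\<xi> s - \<xi> t) * Fx s c"
    if s: "s \<in> S" for s
  proof (cases "\<xi> s" "\<xi> t" rule: linorder_cases)
    case less
    then obtain c where "\<xi> s < c" "c < \<xi> t" "F s (\<xi> t) - F s (\<xi> s) = (\<xi> t - \<xi> s) * Fx s c"
      using MVT2[of "\<xi> s" "\<xi> t" "F s" "Fx s"] Fx[OF s] by auto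
    then show ?thesis by (intro exI[of _ c]) (auto simp: algebra_simps)
  next
    case greater
    then obtain c where "\<xi> t < c" "c < \<xi> s" "F s (\<xi> s) - F s (\<xi> t) = (\<xi> s - \<xi> t) * Fx s c"
      using MVT2[of "\<xi> t" "\<xi> s" "F s" "Fx s"] Fx[OF s] by auto
    then show ?thesis by (intro exI[of _ c]) auto
  qed auto
  then obtain c where c: "\<And>s. s \<in> S \<Longrightarrow> \<bar>c s - \<xi> t\<bar> \<le> \<bar>\<xi> s - \<xi> t\<bar>"
    "\<And>s. s \<in> S \<Longrightarrow> F s (\<xi> s) - F s (\<xi> t) = (\<xi> s - \<xi> t) * Fx s (c s)"
    by metis
  have inS: "\<forall>\<^sub>F s in at t within S. s \<in> S"
    by (simp add: eventually_at_filter)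
  have "(\<xi> \<longlongrightarrow> \<xi> t) (at t within S)"
    using DERIV_continuous[OF \<xi>] by (simp add: continuous_within)
  then have "((\<lambda>s. \<bar>\<xi> s - \<xi> t\<bar>) \<longlongrightarrow> 0) (at t within S)"
    by (auto intro!: tendsto_eq_intros)
  then have "((\<lambda>s. c s - \<xi> t) \<longlongrightarrow> 0) (at t within S)"
    by (rule Lim_null_comparison[rotated]) (use inS c(1) in \<open>auto elim!: eventually_mono\<close>)
  then have c_lim: "(c \<longlongrightarrow> \<xi> t) (at t within S)"
    by (simp add: LIM_zero_iff)
  have "((\<lambda>s. Fx (fst (s, c s)) (snd (s, c s))) \<longlongrightarrow> Fx (fst (t, \<xi> t)) (snd (t, \<xi> t))) (at t within S)"
    by (rule continuous_within_tendsto_compose[OF cont])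
      (use inS c_lim in \<open>auto intro!: tendsto_intros\<close>)
  then have "((\<lambda>s. (F s (\<xi> t) - F t (\<xi> t)) / (s - t) + Fx s (c s) * ((\<xi> s - \<xi> t) / (s - t)))
      \<longlongrightarrow> Dt + Fx t (\<xi> t) * \<xi>') (at t within S)"
    using Ft \<xi> unfolding has_field_derivative_iff by (intro tendsto_intros) auto
  then show ?thesis
    unfolding has_field_derivative_iff
  proof (rule Lim_transform_eventually)
    show "\<forall>\<^sub>F s in at t within S. (F s (\<xi> t) - F t (\<xi> t)) / (s - t) + Fx s (c s) * ((\<xi> s - \<xi> t) / (s - t))
        = (F s (\<xi> s) - F t (\<xi> t)) / (s - t)"
      using inS
    proof eventually_elim
      case (elim s)
      have "F s (\<xi> s) - F t (\<xi> t) = (F s (\<xi> t) - F t (\<xi> t)) + Fx s (c s) * (\<xi> s - \<xi> t)"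
        using c(2)[OF elim] by (simp add: mult.commute)
      then show ?case by (simp add: add_divide_distrib diff_divide_distrib right_diff_distrib)
    qed
  qed
qed

text \<open>If \<open>v''\<close> were positive, \<open>v'\<close> would be positive just to the
  right of its zero \<open>y0\<close>, so \<open>v\<close> would exceed its maximum there.\<close>

lemma second_derivative_at_max:
  fixes v :: "real \<Rightarrow> real"
  assumes v: "\<And>y. (v has_real_derivative v' y) (at y)"
    and v': "(v' has_real_derivative v'') (at y0)"
    and max: "\<And>y. v y \<le> v y0"
  shows "v' y0 = 0" "v'' \<le> 0"
proof -
  show z: "v' y0 = 0"
    by (rule DERIV_local_max[OF v, of 1]) (use max in auto)
  show "v'' \<le> 0"
  proof (rule ccontr)
    assume "\<not> v'' \<le> 0"
    then obtain d where d: "0 < d" "\<And>h. 0 < h \<Longrightarrow> h < d \<Longrightarrow> v' y0 < v' (y0 + h)"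
      using DERIV_pos_inc_right[OF v'] by auto
    obtain c where c: "y0 < c" "c < y0 + d / 2" "v (y0 + d / 2) - v y0 = (y0 + d / 2 - y0) * v' c"
      using MVT2[of y0 "y0 + d / 2" v v'] v d(1) by auto
    have "0 < v' c" using d(2)[of "c - y0"] c z by simp
    then have "v y0 < v (y0 + d / 2)" using c(3) d(1) by (smt (verit) mult_pos_pos half_gt_zero)
    then show False using max[of "y0 + d / 2"] by simp
  qed
qed

text \<open>A positive value would be an interior maximum of \<open>u - \<epsilon> * \<beta>\<close>, where the strict supersolution
  \<open>\<beta> t y = exp (\<lambda> * (T - t)) * (1 + (y - r)\<^sup>2)\<^sup>2\<close> outgrows \<open>u\<close> at infinity.\<close>

lemma parabolic_max_principle:
  fixes u :: "real \<Rightarrow> real \<Rightarrow> real"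
  assumes T: "0 < T"
    and ut: "\<And>t y. t \<in> {0..<T} \<Longrightarrow> ((\<lambda>s. u s y) has_real_derivative ut t y) (at t within {0..<T})"
    and uy: "\<And>t y. t \<in> {0..<T} \<Longrightarrow> ((\<lambda>y. u t y) has_real_derivative uy t y) (at y)"
    and uyy: "\<And>t y. t \<in> {0..<T} \<Longrightarrow> ((\<lambda>y. uy t y) has_real_derivative uyy t y) (at y)"
    and eq: "\<And>t y. t \<in> {0..<T} \<Longrightarrow> ut t y + 1 / 2 * uyy t y * A t + uy t y * (B t * (r - y)) = 0"
    and A: "\<And>t. t \<in> {0..<T} \<Longrightarrow> 0 \<le> A t \<and> A t \<le> K" and B: "\<And>t. t \<in> {0..<T} \<Longrightarrow> 0 \<le> B t"
    and cont: "continuous_on ({0..T} \<times> UNIV) (\<lambda>p. u (fst p) (snd p))"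
    and final: "\<And>y. u T y \<le> 0"
    and growth: "\<And>t y. t \<in> {0..T} \<Longrightarrow> u t y \<le> C * (1 + y\<^sup>2)"
    and t1: "t1 \<in> {0..T}"
  shows "u t1 y1 \<le> 0"
proof (rule ccontr)
  assume pos: "\<not> u t1 y1 \<le> 0"
  have K: "0 \<le> K" using A[of 0] T by auto
  \<comment> \<open>\<open>6 * K\<close> absorbs the diffusion term of \<open>\<beta>\<close>; the
    extra 1 makes the supersolution strict.\<close>
  define lam where "lam = 6 * K + 1"
  define \<beta> where "\<beta> t y = exp (lam * (T - t)) * (1 + (y - r)\<^sup>2)\<^sup>2" for t y
  have \<beta>_ge: "(1 + (y - r)\<^sup>2)\<^sup>2 \<le> \<beta> t y" if "t \<in> {0..T}" for t y
  proof -
    have "1 \<le> exp (lam * (T - t))" using that K by (simp add: lam_def)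
    then show ?thesis unfolding \<beta>_def
      using mult_right_mono[of 1 "exp (lam * (T - t))" "(1 + (y - r)\<^sup>2)\<^sup>2"] by simp
  qed
  have \<beta>_pos: "0 < \<beta> t y" for t y
    unfolding \<beta>_def by (intro mult_pos_pos zero_less_power add_pos_nonneg) auto
  \<comment> \<open>With this choice half of the positive value survives in
    \<open>v\<close>.\<close>
  define \<epsilon> where "\<epsilon> = u t1 y1 / (2 * \<beta> t1 y1)"
  have \<epsilon>: "0 < \<epsilon>" using pos \<beta>_pos by (simp add: \<epsilon>_def)
  define v where "v t y = u t y - \<epsilon> * \<beta> t y" for t y
  have "v t1 y1 = u t1 y1 / 2"
    using \<beta>_pos[of t1 y1] unfolding v_def \<epsilon>_def by simp
  then have v1: "0 < v t1 y1" using pos by simp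
  \<comment> \<open>The growth bound is recentred by \<open>1 + y^2 \<le> (2 + 2 * r^2) * s\<close>
    with \<open>s = 1 + (y - r)^2\<close>, giving \<open>u \<le> C' * s\<close>. Beyond distance
    \<open>R\<close> one has \<open>C' \<le> \<epsilon> * R \<le> \<epsilon> * s\<close>, so the
    quartic term wins.\<close>
  define C' where "C' = \<bar>C\<bar> * (2 + 2 * r\<^sup>2)"
  define R where "R = C' / \<epsilon> + 1"
  have "0 \<le> C'" by (simp add: C'_def)
  then have R: "1 \<le> R" using \<epsilon> by (simp add: R_def)
  have far: "v t y \<le> 0" if "t \<in> {0..T}" "R \<le> \<bar>y - r\<bar>" for t y
  proof -
    define s where "s = 1 + (y - r)\<^sup>2"
    have "R * 1 \<le> R * R" using R by (intro mult_left_mono) auto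
    also have "R * R \<le> \<bar>y - r\<bar> * \<bar>y - r\<bar>" using that R by (intro mult_mono) auto
    finally have s: "R \<le> s" by (simp add: s_def power2_eq_square)
    have "1 + y\<^sup>2 \<le> 1 + (2 * (y - r)\<^sup>2 + 2 * r\<^sup>2)"
      using sum_squares_bound[of "y - r" r] by (simp add: power2_eq_square algebra_simps)
    also have "\<dots> \<le> (2 + 2 * r\<^sup>2) * s"
      unfolding s_def by (simp add: algebra_simps)
    finally have "\<bar>C\<bar> * (1 + y\<^sup>2) \<le> \<bar>C\<bar> * ((2 + 2 * r\<^sup>2) * s)"
      by (intro mult_left_mono) auto
    moreover have "C * (1 + y\<^sup>2) \<le> \<bar>C\<bar> * (1 + y\<^sup>2)" by (intro mult_right_mono) auto
    ultimately have u_le: "u t y \<le> C' * s"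
      using growth[OF that(1), of y] by (simp add: C'_def mult.assoc)
    have "C' \<le> \<epsilon> * R" using \<epsilon> by (simp add: R_def field_simps)
    also have "\<dots> \<le> \<epsilon> * s" using s \<epsilon> by simp
    finally have "C' * s \<le> \<epsilon> * s * s" using s R by (intro mult_right_mono) auto
    also have "\<dots> \<le> \<epsilon> * \<beta> t y"
      using \<beta>_ge[OF that(1), of y] \<epsilon> by (simp add: s_def power2_eq_square mult.assoc)
    finally show ?thesis using u_le by (simp add: v_def)
  qed
  define D where "D = {0..T} \<times> {r - R..r + R}"
  have "compact D" unfolding D_def by (intro compact_Times) auto
  moreover have in_D: "(t1, y1) \<in> D" using far[OF t1, of y1] v1 t1 unfolding D_def by force
  moreover have "continuous_on D (\<lambda>p. v (fst p) (snd p))"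
    unfolding v_def \<beta>_def
    by (intro continuous_intros continuous_on_subset[OF cont]) (auto simp: D_def)
  moreover have "D \<noteq> {}" using in_D by blast
  ultimately obtain p where p: "p \<in> D" "\<And>q. q \<in> D \<Longrightarrow> v (fst q) (snd q) \<le> v (fst p) (snd p)"
    using continuous_attains_sup[of D "\<lambda>p. v (fst p) (snd p)"] by blast
  obtain t0 y0 where ty: "p = (t0, y0)" by (cases p)
  have v0: "0 < v t0 y0" using p(2)[OF in_D] v1 ty by simp
  have max: "v t y \<le> v t0 y0" if "t \<in> {0..T}" for t y
  proof (cases "R \<le> \<bar>y - r\<bar>")
    case True
    then show ?thesis using far[OF that True] v0 by simp
  next
    case False
    then have "(t, y) \<in> D" using that unfolding D_def by auto
    then show ?thesis using p(2)[of "(t, y)"] ty by simp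
  qed
  \<comment> \<open>The terminal condition excludes \<open>t0 = T\<close>. The maximum may lie at
    \<open>t0 = 0\<close>, so the time derivative is tested by forward increments only.\<close>
  have t0: "t0 \<in> {0..<T}"
  proof -
    have "t0 \<noteq> T" using v0 final[of y0] mult_pos_pos[OF \<epsilon> \<beta>_pos[of T y0]] by (auto simp: v_def)
    then show ?thesis using p(1) ty by (auto simp: D_def)
  qed
  define s z where "s = 1 + (y0 - r)\<^sup>2" and "z = y0 - r"
  define e where "e = exp (lam * (T - t0))"
  have v_t: "((\<lambda>t. v t y0) has_real_derivative ut t0 y0 + \<epsilon> * (lam * e * s\<^sup>2)) (at t0 within {0..<T})"
    unfolding v_def \<beta>_def e_def s_def
    by (auto intro!: derivative_eq_intros ut[OF t0])
  have vt: "ut t0 y0 + \<epsilon> * (lam * e * s\<^sup>2) \<le> 0"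
  proof (rule ccontr)
    assume "\<not> ?thesis"
    then obtain d where d: "0 < d" "\<And>h. 0 < h \<Longrightarrow> t0 + h \<in> {0..<T} \<Longrightarrow> h < d \<Longrightarrow> v t0 y0 < v (t0 + h) y0"
      using has_real_derivative_pos_inc_right[OF v_t] by auto
    define h where "h = min (d / 2) ((T - t0) / 2)"
    have "0 < h" "h < d" "h < T - t0" using d(1) t0 by (auto simp: h_def min_def)
    then have "v t0 y0 < v (t0 + h) y0" using d(2)[of h] t0 by auto
    moreover have "v (t0 + h) y0 \<le> v t0 y0"
      using max[of "t0 + h"] \<open>0 < h\<close> \<open>h < T - t0\<close> t0 by auto
    ultimately show False by simp
  qed
  have d1: "((\<lambda>y. v t0 y) has_real_derivative uy t0 y - \<epsilon> * (e * (4 * (1 + (y - r)\<^sup>2) * (y - r)))) (at y)" for y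
    unfolding v_def \<beta>_def e_def
    by (auto intro!: derivative_eq_intros uy[OF t0] simp: algebra_simps)
  have d2: "((\<lambda>y. uy t0 y - \<epsilon> * (e * (4 * (1 + (y - r)\<^sup>2) * (y - r)))) has_real_derivative
      uyy t0 y0 - \<epsilon> * (e * (12 * z\<^sup>2 + 4))) (at y0)"
    unfolding z_def
    by (auto intro!: derivative_eq_intros uyy[OF t0] simp: power2_eq_square algebra_simps)
  note crit = second_derivative_at_max[OF d1 d2 max]
  have vy: "uy t0 y0 = \<epsilon> * (e * (4 * s * z))"
    using crit(1) t0 by (simp add: s_def z_def)
  have vyy: "uyy t0 y0 \<le> \<epsilon> * (e * (12 * z\<^sup>2 + 4))"
    using crit(2) t0 by simp
  have e: "0 < \<epsilon> * e" using \<epsilon> by (simp add: e_def)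
  have s1: "1 \<le> s" "z\<^sup>2 = s - 1" by (simp_all add: s_def z_def)
  have "1 / 2 * uyy t0 y0 * A t0 \<le> 1 / 2 * (\<epsilon> * (e * (12 * z\<^sup>2 + 4))) * A t0"
    using vyy A[OF t0] by (intro mult_right_mono) auto
  also have "\<dots> = \<epsilon> * e * ((6 * z\<^sup>2 + 2) * A t0)" by (simp add: algebra_simps)
  \<comment> \<open>From \<open>z^2 = s - 1\<close>, \<open>6 * z^2 + 2 = 6 * s - 4\<close>, which
    is at most \<open>6 * s^2\<close> because \<open>s \<ge> 1\<close>.\<close>
  also have "\<dots> \<le> \<epsilon> * e * (6 * s\<^sup>2 * K)"
  proof (intro mult_left_mono mult_mono)
    have "6 * (s - 1) + 2 \<le> 6 * q" if "s \<le> q" for q :: real using that by simp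
    moreover have "s \<le> s\<^sup>2" using s1(1) by (rule self_le_power) simp
    ultimately show "6 * z\<^sup>2 + 2 \<le> 6 * s\<^sup>2" unfolding s1(2) by blast
  qed (use A[OF t0] e in auto)
  finally have term1: "1 / 2 * uyy t0 y0 * A t0 \<le> \<epsilon> * e * (6 * s\<^sup>2 * K)" .
  \<comment> \<open>At the critical point \<open>uy\<close> is a positive multiple of
    \<open>y0 - r\<close>, while the drift is a nonnegative multiple of
    \<open>r - y0\<close>.\<close>
  have "uy t0 y0 * (B t0 * (r - y0)) = - (\<epsilon> * e * (4 * s * B t0 * z\<^sup>2))"
    unfolding vy by (simp add: z_def power2_eq_square algebra_simps)
  also have "\<dots> \<le> 0" using \<epsilon> s1(1) B[OF t0] unfolding e_def neg_le_0_iff_le by (intro mult_nonneg_nonneg) auto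
  finally have "uy t0 y0 * (B t0 * (r - y0)) \<le> 0" .
  with term1 vt eq[OF t0, of y0] have "\<epsilon> * (lam * e * s\<^sup>2) \<le> \<epsilon> * e * (6 * s\<^sup>2 * K)" by linarith
  then have "\<epsilon> * e * s\<^sup>2 \<le> 0" by (simp add: lam_def algebra_simps)
  moreover have "0 < \<epsilon> * e * s\<^sup>2" using e s1(1) by simp
  ultimately show False by simp
qed

section \<open>Comparison of two admissible solutions\<close>

lemma C12_derivatives:
  assumes "C12 T f" "t \<in> {0..<T}"
  shows "((\<lambda>s. f s y) has_real_derivative D_t T f t y) (at t within {0..<T})"
    "((\<lambda>y. f t y) has_real_derivative D_y f t y) (at y)"
    "((\<lambda>y. D_y f t y) has_real_derivative D_y (D_y f) t y) (at y)"
proof -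
  have d: "(\<lambda>s. f s y) differentiable (at t within {0..<T})" "(\<lambda>x. f t x) differentiable (at y)"
    "(\<lambda>x. D_y f t x) differentiable (at y)"
    using assms unfolding C12_def by auto
  show "((\<lambda>s. f s y) has_real_derivative D_t T f t y) (at t within {0..<T})"
    using d(1) unfolding D_t_def has_real_derivative_iff_has_vector_derivative
    by (simp add: vector_derivative_works)
  show "((\<lambda>y. f t y) has_real_derivative D_y f t y) (at y)"
    using d(2) unfolding D_y_def by (simp add: DERIV_deriv_iff_real_differentiable)
  show "((\<lambda>y. D_y f t y) has_real_derivative D_y (D_y f) t y) (at y)"
    using d(3) unfolding D_y_def[of "D_y f"] by (simp add: DERIV_deriv_iff_real_differentiable)
qed

text \<open>\<open>1 / \<gamma>\<close> increases in time, so the upper bound is the value at time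
  0. It bounds the diffusion coefficient in the maximum principle.\<close>

lemma gam_bounds:
  assumes "\<sigma> > 0" "\<sigma>\<^sub>0 > 0" "t \<ge> 0"
  shows "0 < gam \<sigma> \<sigma>\<^sub>0 t" "gam \<sigma> \<sigma>\<^sub>0 t \<le> \<sigma>\<^sub>0\<^sup>2"
proof -
  have "0 < 1 / \<sigma>\<^sub>0\<^sup>2" "1 / \<sigma>\<^sub>0\<^sup>2 \<le> 1 / \<sigma>\<^sub>0\<^sup>2 + t / \<sigma>\<^sup>2" using assms by auto
  then show "0 < gam \<sigma> \<sigma>\<^sub>0 t" "gam \<sigma> \<sigma>\<^sub>0 t \<le> \<sigma>\<^sub>0\<^sup>2"
    unfolding gam_def using frac_le[of 1 1 "1 / \<sigma>\<^sub>0\<^sup>2" "1 / \<sigma>\<^sub>0\<^sup>2 + t / \<sigma>\<^sup>2"] by (auto intro: add_pos_nonneg)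
qed

text \<open>The source cancels in \<open>g - f\<close>, which solves the homogeneous equation with
  terminal value 0 and still has quadratic growth. As \<open>f\<close> and \<open>g\<close> can be
  exchanged, one inequality is enough for uniqueness.\<close>

lemma admissible_solution_le:
  assumes "T > 0" "\<sigma> > 0" "\<sigma>\<^sub>0 > 0"
    and f: "admissible_solution T \<sigma> \<sigma>\<^sub>0 a r f" and g: "admissible_solution T \<sigma> \<sigma>\<^sub>0 a r g"
    and t: "t \<in> {0..T}"
  shows "g t y \<le> f t y"
proof -
  obtain Cf where Cf: "\<And>t y. t \<in> {0..T} \<Longrightarrow> \<bar>f t y\<bar> \<le> Cf * (1 + y\<^sup>2)"
    using f unfolding admissible_solution_def quadratic_growth_def by blast
  obtain Cg where Cg: "\<And>t y. t \<in> {0..T} \<Longrightarrow> \<bar>g t y\<bar> \<le> Cg * (1 + y\<^sup>2)"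
    using g unfolding admissible_solution_def quadratic_growth_def by blast
  have C12: "C12 T f" "C12 T g" using f g by (auto simp: admissible_solution_def)
  note df = C12_derivatives[OF C12(1)] and dg = C12_derivatives[OF C12(2)]
  have "g t y - f t y \<le> 0"
  proof (rule parabolic_max_principle[where u="\<lambda>t y. g t y - f t y" and T=T and r=r
        and ut="\<lambda>t y. D_t T g t y - D_t T f t y" and uy="\<lambda>t y. D_y g t y - D_y f t y"
        and uyy="\<lambda>t y. D_y (D_y g) t y - D_y (D_y f) t y"
        and A="\<lambda>t. (gam \<sigma> \<sigma>\<^sub>0 t)\<^sup>2 / \<sigma>\<^sup>2" and B="\<lambda>t. gam \<sigma> \<sigma>\<^sub>0 t / \<sigma>\<^sup>2"
        and K="(\<sigma>\<^sub>0\<^sup>2)\<^sup>2 / \<sigma>\<^sup>2" and C="Cf + Cg"])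
    fix t y assume t: "t \<in> {0..<T}"
    have eqs: "D_t T f t y + 1 / 2 * D_y (D_y f) t y * ((gam \<sigma> \<sigma>\<^sub>0 t)\<^sup>2 / \<sigma>\<^sup>2)
        + D_y f t y * (gam \<sigma> \<sigma>\<^sub>0 t * (r - y) / \<sigma>\<^sup>2) - source \<sigma> \<sigma>\<^sub>0 a r t y = 0"
      "D_t T g t y + 1 / 2 * D_y (D_y g) t y * ((gam \<sigma> \<sigma>\<^sub>0 t)\<^sup>2 / \<sigma>\<^sup>2)
        + D_y g t y * (gam \<sigma> \<sigma>\<^sub>0 t * (r - y) / \<sigma>\<^sup>2) - source \<sigma> \<sigma>\<^sub>0 a r t y = 0"
      using f g t unfolding admissible_solution_def solves_cauchy_def by blast+
    have sub: "p2 - p1 + 1 / 2 * (q2 - q1) * c + (s2 - s1) * d = 0"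
      if "p1 + 1 / 2 * q1 * c + s1 * d - S = 0" "p2 + 1 / 2 * q2 * c + s2 * d - S = 0"
      for p1 p2 q1 q2 s1 s2 c d S :: real
      using that by (simp add: algebra_simps diff_divide_distrib)
    show "D_t T g t y - D_t T f t y
        + 1 / 2 * (D_y (D_y g) t y - D_y (D_y f) t y) * ((gam \<sigma> \<sigma>\<^sub>0 t)\<^sup>2 / \<sigma>\<^sup>2)
        + (D_y g t y - D_y f t y) * (gam \<sigma> \<sigma>\<^sub>0 t / \<sigma>\<^sup>2 * (r - y)) = 0"
      using sub[OF eqs] by simp
  next
    fix t assume "t \<in> {0..<T}"
    then show "0 \<le> (gam \<sigma> \<sigma>\<^sub>0 t)\<^sup>2 / \<sigma>\<^sup>2 \<and> (gam \<sigma> \<sigma>\<^sub>0 t)\<^sup>2 / \<sigma>\<^sup>2 \<le> (\<sigma>\<^sub>0\<^sup>2)\<^sup>2 / \<sigma>\<^sup>2"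
      "0 \<le> gam \<sigma> \<sigma>\<^sub>0 t / \<sigma>\<^sup>2"
      using gam_bounds[OF assms(2,3), of t] power_mono[of "gam \<sigma> \<sigma>\<^sub>0 t" "\<sigma>\<^sub>0\<^sup>2" 2]
      by (auto intro!: divide_right_mono)
  next
    show "continuous_on ({0..T} \<times> UNIV) (\<lambda>p. g (fst p) (snd p) - f (fst p) (snd p))"
      using f g by (intro continuous_on_diff) (auto simp: admissible_solution_def case_prod_beta')
  next
    fix t y assume "t \<in> {0..T}"
    then show "g t y - f t y \<le> (Cf + Cg) * (1 + y\<^sup>2)"
      using Cf[of t y] Cg[of t y] by (simp add: distrib_right)
  next
    fix y show "g T y - f T y \<le> 0"
      using f g by (simp add: admissible_solution_def solves_cauchy_def)
  qed (use assms t in \<open>auto intro!: derivative_intros df dg\<close>)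
  then show ?thesis by simp
qed

section \<open>Existence and uniqueness\<close>

text \<open>Each indicator selects a positive part, after the sign of the first base is reversed
  inside its square. In this form the source is visibly continuous, and reflection of
  \<open>y\<close> about \<open>r\<close> exchanges its two terms.\<close>

lemma source_eq:
  "source \<sigma> \<sigma>\<^sub>0 a r t y =
    ((max 0 (y - r - a * sqrt (gam \<sigma> \<sigma>\<^sub>0 t)))\<^sup>2 + (max 0 (- (y - r) - a * sqrt (gam \<sigma> \<sigma>\<^sub>0 t)))\<^sup>2) / (2 * \<sigma>\<^sup>2)"
proof -
  have "(r - y + a * sqrt (gam \<sigma> \<sigma>\<^sub>0 t))\<^sup>2 = (y - r - a * sqrt (gam \<sigma> \<sigma>\<^sub>0 t))\<^sup>2"
    by (simp add: power2_eq_square algebra_simps)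
  then have "(r - y + a * sqrt (gam \<sigma> \<sigma>\<^sub>0 t))\<^sup>2 * of_bool (r - y + a * sqrt (gam \<sigma> \<sigma>\<^sub>0 t) \<le> 0)
      = (max 0 (y - r - a * sqrt (gam \<sigma> \<sigma>\<^sub>0 t)))\<^sup>2"
    by (auto simp: max_def of_bool_def)
  moreover have "(r - y - a * sqrt (gam \<sigma> \<sigma>\<^sub>0 t))\<^sup>2 * of_bool (r - y - a * sqrt (gam \<sigma> \<sigma>\<^sub>0 t) \<ge> 0)
      = (max 0 (- (y - r) - a * sqrt (gam \<sigma> \<sigma>\<^sub>0 t)))\<^sup>2"
    by (auto simp: max_def of_bool_def)
  ultimately show ?thesis
    unfolding source_def by (simp add: add_divide_distrib)
qed

lemma max_mult_scale: "c * max 0 (u::real) = max 0 (c * u)" if "0 \<le> c"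
  using that by (auto simp: max_def zero_le_mult_iff mult_le_0_iff)

text \<open>Differentiability in \<open>y\<close> is claimed separately up to \<open>t = T\<close>:
  \<open>C12\<close> stops short of \<open>T\<close>, and a bound on \<open>D_y\<close> is
  informative only where the derivative exists.\<close>

lemma admissible_solution_exists:
  assumes T: "T > 0" and \<sigma>: "\<sigma> > 0" and \<sigma>\<^sub>0: "\<sigma>\<^sub>0 > 0"
  shows "\<exists>f. admissible_solution T \<sigma> \<sigma>\<^sub>0 a r f \<and>
           (\<forall>t\<in>{0..T}. \<forall>y. (\<lambda>x. f t x) differentiable (at y)) \<and>
           (\<exists>C\<^sub>2>0. \<forall>y. \<forall>t\<in>{0..T}. \<bar>D_y f t y\<bar> \<le> C\<^sub>2 * (1 + \<bar>y\<bar>))"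
proof -
  define h where "h t = 1 / \<sigma>\<^sub>0\<^sup>2 + t / \<sigma>\<^sup>2" for t
  have gam_h: "gam \<sigma> \<sigma>\<^sub>0 t = 1 / h t" for t by (simp add: gam_def h_def)
  have h_pos: "0 < h t" if "0 \<le> t" for t
    unfolding h_def using that \<sigma> \<sigma>\<^sub>0 by (intro add_pos_nonneg) auto
  have h_le: "h t \<le> h T" if "t \<le> T" for t
    unfolding h_def using that by (intro add_left_mono divide_right_mono) auto
  have h_cont [continuous_intros]: "continuous_on A h" for A
    unfolding h_def by (intro continuous_intros) (use \<sigma> in auto)
  have h_meas [measurable]: "h \<in> borel_measurable borel"
    by (intro borel_measurable_continuous_onI h_cont)
  have h_deriv: "(h has_real_derivative 1 / \<sigma>\<^sup>2) (at t within S)" for t S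
    unfolding h_def[abs_def]
    using DERIV_add[OF DERIV_const DERIV_cdivide[OF DERIV_ident], of "1 / \<sigma>\<^sub>0\<^sup>2" "\<sigma>\<^sup>2"] by simp
  \<comment> \<open>With \<open>y - r = x / h(t)\<close> one gets
    \<open>y - r - a * sqrt \<gamma> = (x - a * sqrt h) / h\<close>. This gives the threshold
    \<open>b\<close>, and the squared factor \<open>1 / h\<close> goes into the weight
    \<open>w\<close>. The diffusion is \<open>1 / \<sigma>^2\<close> because
    \<open>f_yy = h^2 * F_xx\<close> cancels \<open>\<gamma>^2\<close>.\<close>
  define w where "w t = 1 / (2 * \<sigma>\<^sup>2 * (h t)\<^sup>2)" for t
  define b where "b t = a * sqrt (h t)" for t
  interpret heat_source T "1 / \<sigma>\<^sup>2" w b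
  proof
    show "continuous_on {0..T} w"
      unfolding w_def using h_pos \<sigma> by (intro continuous_intros) force
    show "continuous_on {0..T} b"
      unfolding b_def by (intro continuous_intros)
    show "w \<in> borel_measurable borel" "b \<in> borel_measurable borel"
      unfolding w_def b_def by measurable
  qed (use T \<sigma> in auto)

  \<comment> \<open>The equation runs backward from terminal value 0 with the source on the right,
    hence the minus sign; the argument \<open>- x\<close> accounts for the second square.\<close>
  define F where "F t x = - (duhamel ker t x + duhamel ker t (- x))" for t x
  define Fx where "Fx t x = - (duhamel ker_u t x - duhamel ker_u t (- x))" for t x
  define Fxx where "Fxx t x = - (duhamel ker_uu t x + duhamel ker_uu t (- x))" for t x
  have reflect: "((\<lambda>x. duhamel P t (- x)) has_real_derivative - duhamel P' t (- x)) (at x)"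
    if "((\<lambda>x. duhamel P t x) has_real_derivative duhamel P' t (- x)) (at (- x))" for P P' t x
    using DERIV_chain2[OF that DERIV_minus[OF DERIV_ident]] by simp
  note du = DERIV_duhamel[OF regular_ker regular_ker_u DERIV_ker]
    DERIV_duhamel[OF regular_ker_u regular_ker_uu DERIV_ker_u]
  have F_x: "((\<lambda>x. F t x) has_real_derivative Fx t x) (at x)"
    and F_xx: "((\<lambda>x. Fx t x) has_real_derivative Fxx t x) (at x)" if "t \<in> {0..T}" for t x
    unfolding F_def Fx_def Fxx_def
    by (rule derivative_eq_intros du[OF _ that] reflect[OF du(1)[OF _ that]] reflect[OF du(2)[OF _ that]]
        | assumption | simp)+
  have F_t: "((\<lambda>t. F t x) has_real_derivative
      - (1 / (2 * \<sigma>\<^sup>2)) * Fxx t x + w t * ((max 0 (x - b t))\<^sup>2 + (max 0 (- x - b t))\<^sup>2))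
      (at t within {0..<T})" if "t \<in> {0..<T}" for t x
  proof -
    have eq: "- (- (1 / \<sigma>\<^sup>2 / 2) * duhamel ker_uu t x - w t * (max 0 (x - b t))\<^sup>2
        + (- (1 / \<sigma>\<^sup>2 / 2) * duhamel ker_uu t (- x) - w t * (max 0 (- x - b t))\<^sup>2))
      = - (1 / (2 * \<sigma>\<^sup>2)) * Fxx t x + w t * ((max 0 (x - b t))\<^sup>2 + (max 0 (- x - b t))\<^sup>2)"
      by (simp add: Fxx_def algebra_simps add_divide_distrib)
    show ?thesis
      unfolding F_def eq[symmetric]
      by (intro DERIV_minus DERIV_add DERIV_duhamel_time that)
  qed
  have cont: "continuous_on ({0..T} \<times> UNIV) (\<lambda>p. F (fst p) (snd p))"
    "continuous_on ({0..T} \<times> UNIV) (\<lambda>p. Fx (fst p) (snd p))"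
    "continuous_on ({0..T} \<times> UNIV) (\<lambda>p. Fxx (fst p) (snd p))"
  proof -
    have "continuous_on ({0..T} \<times> UNIV) (\<lambda>p. duhamel P (fst p) (- snd p))" if "regular_kernel P" for P
    proof -
      have "continuous_on ({0..T} \<times> UNIV)
          (\<lambda>q. (\<lambda>p. duhamel P (fst p) (snd p)) ((\<lambda>p. (fst p, - snd p)) q))"
        by (rule continuous_on_compose2[OF continuous_on_duhamel[OF that]])
          (auto intro!: continuous_intros)
      then show ?thesis by simp
    qed
    then show "continuous_on ({0..T} \<times> UNIV) (\<lambda>p. F (fst p) (snd p))"
      "continuous_on ({0..T} \<times> UNIV) (\<lambda>p. Fx (fst p) (snd p))"
      "continuous_on ({0..T} \<times> UNIV) (\<lambda>p. Fxx (fst p) (snd p))"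
      unfolding F_def Fx_def Fxx_def
      by (intro continuous_intros continuous_on_duhamel regular_ker regular_ker_u regular_ker_uu; simp add: regular_ker regular_ker_u regular_ker_uu)+
  qed

  define f where "f t y = F t ((y - r) * h t)" for t y
  have f_y: "((\<lambda>y. f t y) has_real_derivative Fx t ((y - r) * h t) * h t) (at y)"
    if "t \<in> {0..T}" for t y
    unfolding f_def by (rule DERIV_chain2[OF F_x[OF that]]) (auto intro!: derivative_eq_intros)
  have Dy: "D_y f t y = Fx t ((y - r) * h t) * h t" if "t \<in> {0..T}" for t y
    unfolding D_y_def by (rule DERIV_imp_deriv[OF f_y[OF that]])
  have f_yy: "((\<lambda>y. D_y f t y) has_real_derivative Fxx t ((y - r) * h t) * (h t)\<^sup>2) (at y)"
    if "t \<in> {0..T}" for t y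
  proof -
    have "((\<lambda>y. Fx t ((y - r) * h t)) has_real_derivative Fxx t ((y - r) * h t) * h t) (at y)"
      by (rule DERIV_chain2[OF F_xx[OF that]]) (auto intro!: derivative_eq_intros)
    from DERIV_cmult_right[OF this, of "h t"] show ?thesis
      unfolding Dy[OF that, abs_def] by (simp add: power2_eq_square mult.assoc)
  qed
  have Dyy: "D_y (D_y f) t y = Fxx t ((y - r) * h t) * (h t)\<^sup>2" if "t \<in> {0..T}" for t y
    unfolding D_y_def[of "D_y f"] by (rule DERIV_imp_deriv[OF f_yy[OF that]])
  have f_t: "((\<lambda>t. f t y) has_real_derivative source \<sigma> \<sigma>\<^sub>0 a r t y
      - 1 / (2 * \<sigma>\<^sup>2) * Fxx t ((y - r) * h t) + Fx t ((y - r) * h t) * ((y - r) / \<sigma>\<^sup>2))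
      (at t within {0..<T})" if t: "t \<in> {0..<T}" for t y
  proof -
    define x where "x = (y - r) * h t"
    have ht: "0 < h t" using t h_pos by simp
    have scale: "w t * (max 0 (u - b t))\<^sup>2 = (max 0 (u / h t - a * sqrt (gam \<sigma> \<sigma>\<^sub>0 t)))\<^sup>2 / (2 * \<sigma>\<^sup>2)" for u
    proof -
      have "b t / h t = a * sqrt (gam \<sigma> \<sigma>\<^sub>0 t)"
        using ht by (simp add: b_def gam_h real_sqrt_divide field_simps)
      then have "max 0 (u / h t - a * sqrt (gam \<sigma> \<sigma>\<^sub>0 t)) = max 0 (u - b t) / h t"
        using max_mult_scale[of "1 / h t" "u - b t"] ht by (simp add: diff_divide_distrib)
      then show ?thesis by (simp add: w_def power_divide)
    qed
    have "source \<sigma> \<sigma>\<^sub>0 a r t y = w t * ((max 0 (x - b t))\<^sup>2 + (max 0 (- x - b t))\<^sup>2)"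
      unfolding source_eq distrib_left scale using ht
      by (simp add: x_def add_divide_distrib[symmetric])
    moreover have "((\<lambda>t. F t ((y - r) * h t)) has_real_derivative
      - (1 / (2 * \<sigma>\<^sup>2)) * Fxx t x + w t * ((max 0 (x - b t))\<^sup>2 + (max 0 (- x - b t))\<^sup>2)
      + Fx t x * ((y - r) / \<sigma>\<^sup>2)) (at t within {0..<T})"
      unfolding x_def
    \<comment> \<open>For fixed \<open>y\<close> the position \<open>x = (y - r) * h(t)\<close>
      moves with velocity \<open>(y - r) / \<sigma>^2\<close>; this yields the transport term that
      cancels the drift.\<close>
    proof (rule has_real_derivative_along_curve[OF t F_t[OF t] F_x])
      show "((\<lambda>t. (y - r) * h t) has_real_derivative (y - r) / \<sigma>\<^sup>2) (at t within {0..<T})"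
        using DERIV_cmult[OF h_deriv, of "y - r"] by simp
      have "continuous_on ({0..<T} \<times> UNIV) (\<lambda>p. Fx (fst p) (snd p))"
        by (rule continuous_on_subset[OF cont(2)]) auto
      then show "continuous (at (t, (y - r) * h t) within {0..<T} \<times> UNIV) (\<lambda>p. Fx (fst p) (snd p))"
        using t by (auto simp: continuous_on_eq_continuous_within)
    qed auto
    ultimately show ?thesis unfolding f_def x_def by (simp add: algebra_simps)
  qed
  have Dt: "D_t T f t y = source \<sigma> \<sigma>\<^sub>0 a r t y
      - 1 / (2 * \<sigma>\<^sup>2) * Fxx t ((y - r) * h t) + Fx t ((y - r) * h t) * ((y - r) / \<sigma>\<^sup>2)"
    if t: "t \<in> {0..<T}" for t y
  proof -
    \<comment> \<open>A \<open>vector_derivative\<close> within a set is determined only at a limit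
      point of that set; at \<open>t = 0\<close> the points to the right provide this.\<close>
    have "t islimpt {t<..<T}" using t by (intro islimpt_greaterThanLessThan1) auto
    then have "t islimpt {0..<T}" by (rule islimpt_subset) (use t in auto)
    then have "at t within {0..<T} \<noteq> bot" by (simp add: trivial_limit_within)
    then show ?thesis
      unfolding D_t_def using f_t[OF t, of y]
      by (intro vector_derivative_within) (simp_all add: has_real_derivative_iff_has_vector_derivative)
  qed

  have change_var: "continuous_on (S \<times> UNIV) (\<lambda>p. G (fst p) ((snd p - r) * h (fst p)))"
    if "continuous_on ({0..T} \<times> UNIV) (\<lambda>p. G (fst p) (snd p))" "S \<subseteq> {0..T}" for S and G :: "real \<Rightarrow> real \<Rightarrow> real"
  proof -
    have "continuous_on (S \<times> UNIV) (\<lambda>q. (\<lambda>p. G (fst p) (snd p)) ((\<lambda>p. (fst p, (snd p - r) * h (fst p))) q))"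
      by (rule continuous_on_compose2[OF that(1)])
        (use that(2) in \<open>auto intro!: continuous_intros continuous_on_compose2[OF h_cont[of UNIV]]\<close>)
    then show ?thesis by simp
  qed
  have h_fst: "continuous_on A (\<lambda>p::real\<times>real. h (fst p))" for A
    by (intro continuous_on_compose2[OF h_cont[of UNIV]] continuous_intros) auto
  have sub: "{0..<T} \<subseteq> {0..T}" by auto
  have C12: "C12 T f"
    unfolding C12_def case_prod_beta'
  proof (intro conjI ballI allI)
    fix t y assume t: "t \<in> {0..<T}"
    then have t': "t \<in> {0..T}" by auto
    show "(\<lambda>s. f s y) differentiable (at t within {0..<T})"
      using f_t[OF t, of y] real_differentiable_def by blast
    show "(\<lambda>x. f t x) differentiable (at y)" "(\<lambda>x. D_y f t x) differentiable (at y)"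
      using f_y[OF t', of y] f_yy[OF t', of y] real_differentiable_def by blast+
  next
    show "continuous_on ({0..<T} \<times> UNIV) (\<lambda>p. f (fst p) (snd p))"
      unfolding f_def by (rule change_var[OF cont(1) sub])
    have "continuous_on ({0..<T} \<times> UNIV) (\<lambda>p. Fx (fst p) ((snd p - r) * h (fst p)) * h (fst p))"
      by (intro continuous_on_mult change_var[OF cont(2) sub] h_fst)
    then show "continuous_on ({0..<T} \<times> UNIV) (\<lambda>p. D_y f (fst p) (snd p))"
      by (rule continuous_on_cong[THEN iffD1, rotated -1]) (auto simp: Dy)
    have "continuous_on ({0..<T} \<times> UNIV) (\<lambda>p. Fxx (fst p) ((snd p - r) * h (fst p)) * (h (fst p))\<^sup>2)"
      by (intro continuous_on_mult continuous_on_power change_var[OF cont(3) sub] h_fst)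
    then show "continuous_on ({0..<T} \<times> UNIV) (\<lambda>p. D_y (D_y f) (fst p) (snd p))"
      by (rule continuous_on_cong[THEN iffD1, rotated -1]) (auto simp: Dyy)
    have "continuous_on ({0..<T} \<times> UNIV) (\<lambda>p::real\<times>real. gam \<sigma> \<sigma>\<^sub>0 (fst p))"
      unfolding gam_h using h_pos by (intro continuous_on_divide continuous_on_const h_fst) force
    then have "continuous_on ({0..<T} \<times> UNIV) (\<lambda>p. source \<sigma> \<sigma>\<^sub>0 a r (fst p) (snd p)
        - 1 / (2 * \<sigma>\<^sup>2) * Fxx (fst p) ((snd p - r) * h (fst p))
        + Fx (fst p) ((snd p - r) * h (fst p)) * ((snd p - r) / \<sigma>\<^sup>2))"
      unfolding source_eq using \<sigma>
      by (intro continuous_intros change_var[OF cont(2) sub] change_var[OF cont(3) sub]) auto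
    then show "continuous_on ({0..<T} \<times> UNIV) (\<lambda>p. D_t T f (fst p) (snd p))"
      by (rule continuous_on_cong[THEN iffD1, rotated -1]) (auto simp: Dt)
  qed

  have solves: "solves_cauchy T \<sigma> \<sigma>\<^sub>0 a r f"
    unfolding solves_cauchy_def
  proof (intro conjI ballI allI)
    fix t y assume t: "t \<in> {0..<T}"
    then have t': "t \<in> {0..T}" and ht: "h t \<noteq> 0" using h_pos[of t] by auto
    have "1 / 2 * D_y (D_y f) t y * ((gam \<sigma> \<sigma>\<^sub>0 t)\<^sup>2 / \<sigma>\<^sup>2) = 1 / (2 * \<sigma>\<^sup>2) * Fxx t ((y - r) * h t)"
      unfolding Dyy[OF t'] gam_h using ht by (simp add: power_divide)
    moreover have "D_y f t y * (gam \<sigma> \<sigma>\<^sub>0 t * (r - y) / \<sigma>\<^sup>2) = - (Fx t ((y - r) * h t) * ((y - r) / \<sigma>\<^sup>2))"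
      unfolding Dy[OF t'] gam_h using ht \<sigma> by (simp add: field_simps)
    ultimately show "D_t T f t y + 1 / 2 * D_y (D_y f) t y * ((gam \<sigma> \<sigma>\<^sub>0 t)\<^sup>2 / \<sigma>\<^sup>2)
        + D_y f t y * (gam \<sigma> \<sigma>\<^sub>0 t * (r - y) / \<sigma>\<^sup>2) - source \<sigma> \<sigma>\<^sub>0 a r t y = 0"
      unfolding Dt[OF t] by linarith
  next
    \<comment> \<open>At \<open>t = T\<close> the interval of integration \<open>{T<..T}\<close> is
      empty.\<close>
    show "f T y = 0" for y by (simp add: f_def F_def duhamel_def)
  qed
  have f_cont: "continuous_on ({0..T} \<times> UNIV) (\<lambda>(t, y). f t y)"
    unfolding f_def case_prod_beta' by (rule change_var[OF cont(1) order_refl])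

  obtain C where C: "0 < C" "\<And>t x. t \<in> {0..T} \<Longrightarrow> \<bar>duhamel ker t x\<bar> \<le> C * (1 + x\<^sup>2)"
    "\<And>t x. t \<in> {0..T} \<Longrightarrow> \<bar>duhamel ker_u t x\<bar> \<le> C * (1 + \<bar>x\<bar>)"
    using duhamel_bound by blast
  define H where "H = h T"
  have H: "0 < H" using h_pos[of T] T by (simp add: H_def)
  have x_le: "\<bar>(y - r) * h t\<bar> \<le> (\<bar>y\<bar> + \<bar>r\<bar>) * H" if "t \<in> {0..T}" for t y
    using that h_pos[of t] h_le[of t] unfolding abs_mult H_def by (intro mult_mono) auto
  \<comment> \<open>The 2 counts the two reflected integrals; the bracket comes from
    \<open>((y - r) * h t)^2 \<le> (2 * y^2 + 2 * r^2) * H^2\<close>, where \<open>H\<close> is the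
    largest value of \<open>h\<close> on \<open>{0..T}\<close>.\<close>
  define C1 where "C1 = 2 * C * (1 + 2 * H\<^sup>2 + 2 * H\<^sup>2 * r\<^sup>2)"
  have growth: "quadratic_growth T f"
    unfolding quadratic_growth_def
  proof (intro exI[of _ C1] conjI allI ballI)
    show "0 < C1" unfolding C1_def using C(1) by (intro mult_pos_pos add_pos_nonneg) auto
    fix t y assume t: "t \<in> {0..T}"
    have "((y - r) * h t)\<^sup>2 \<le> ((\<bar>y\<bar> + \<bar>r\<bar>) * H)\<^sup>2"
      using x_le[OF t, of y] H by (intro power2_le_iff_abs_le[THEN iffD2]) auto
    also have "\<dots> \<le> (2 * y\<^sup>2 + 2 * r\<^sup>2) * H\<^sup>2"
      unfolding power_mult_distrib using sum_squares_bound[of "\<bar>y\<bar>" "\<bar>r\<bar>"]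
      by (intro mult_right_mono) (auto simp: power2_sum)
    finally have "1 + ((y - r) * h t)\<^sup>2 \<le> 1 + (2 * y\<^sup>2 + 2 * r\<^sup>2) * H\<^sup>2" by simp
    also have "\<dots> \<le> (1 + 2 * H\<^sup>2 + 2 * H\<^sup>2 * r\<^sup>2) * (1 + y\<^sup>2)"
      by (simp add: algebra_simps)
    finally have "2 * C * (1 + ((y - r) * h t)\<^sup>2) \<le> C1 * (1 + y\<^sup>2)"
      unfolding C1_def mult.assoc[of "2 * C"] using C(1) by (intro mult_left_mono) auto
    moreover have "\<bar>f t y\<bar> \<le> 2 * C * (1 + ((y - r) * h t)\<^sup>2)"
      unfolding f_def F_def using C(2)[OF t, of "(y - r) * h t"] C(2)[OF t, of "- ((y - r) * h t)"]
      by (simp add: power2_minus)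
    ultimately show "\<bar>f t y\<bar> \<le> C1 * (1 + y\<^sup>2)" by linarith
  qed
  have "admissible_solution T \<sigma> \<sigma>\<^sub>0 a r f"
    using C12 solves f_cont growth unfolding admissible_solution_def by blast
  moreover have "\<forall>t\<in>{0..T}. \<forall>y. (\<lambda>x. f t x) differentiable (at y)"
    using f_y real_differentiable_def by blast
  moreover have "\<exists>C\<^sub>2>0. \<forall>y. \<forall>t\<in>{0..T}. \<bar>D_y f t y\<bar> \<le> C\<^sub>2 * (1 + \<bar>y\<bar>)"
  \<comment> \<open>The bracket dominates \<open>1 + (\<bar>y\<bar> + \<bar>r\<bar>) * H\<close> up
    to the factor \<open>1 + \<bar>y\<bar>\<close>; the last \<open>H\<close> bounds the inner
    derivative \<open>h t\<close> of the change of variable.\<close>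
  proof (intro exI[of _ "2 * C * (1 + H + \<bar>r\<bar> * H) * H"] conjI allI ballI)
    show "0 < 2 * C * (1 + H + \<bar>r\<bar> * H) * H" using C(1) H by (intro mult_pos_pos add_pos_nonneg) auto
    fix t y assume t: "t \<in> {0..T}"
    have ht: "0 \<le> h t" "h t \<le> H" using h_pos[of t] h_le[of t] t by (auto simp: H_def)
    have "(1 + H + \<bar>r\<bar> * H) * (1 + \<bar>y\<bar>) = 1 + (\<bar>y\<bar> + \<bar>r\<bar>) * H + (H + \<bar>y\<bar> + H * \<bar>r\<bar> * \<bar>y\<bar>)"
      by (simp add: algebra_simps)
    moreover have "0 \<le> H + \<bar>y\<bar> + H * \<bar>r\<bar> * \<bar>y\<bar>" using H by simp
    ultimately have "1 + \<bar>(y - r) * h t\<bar> \<le> (1 + H + \<bar>r\<bar> * H) * (1 + \<bar>y\<bar>)"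
      using x_le[OF t, of y] by linarith
    then have "2 * C * (1 + \<bar>(y - r) * h t\<bar>) \<le> 2 * C * ((1 + H + \<bar>r\<bar> * H) * (1 + \<bar>y\<bar>))"
      using C(1) by (intro mult_left_mono) auto
    moreover have "\<bar>Fx t ((y - r) * h t)\<bar> \<le> 2 * C * (1 + \<bar>(y - r) * h t\<bar>)"
      unfolding Fx_def using C(3)[OF t, of "(y - r) * h t"] C(3)[OF t, of "- ((y - r) * h t)"]
      unfolding abs_minus_cancel by linarith
    ultimately have "\<bar>Fx t ((y - r) * h t)\<bar> \<le> 2 * C * ((1 + H + \<bar>r\<bar> * H) * (1 + \<bar>y\<bar>))"
      by (rule order_trans[rotated])
    then have "\<bar>Fx t ((y - r) * h t)\<bar> * h t \<le> 2 * C * ((1 + H + \<bar>r\<bar> * H) * (1 + \<bar>y\<bar>)) * H"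
      using ht C(1) H by (intro mult_mono) auto
    then show "\<bar>D_y f t y\<bar> \<le> 2 * C * (1 + H + \<bar>r\<bar> * H) * H * (1 + \<bar>y\<bar>)"
      unfolding Dy[OF t] abs_mult using ht by (simp add: mult_ac)
  qed
  ultimately show ?thesis by blast
qed

text \<open>Uniqueness means agreement on \<open>{0..T}\<close>, since the values of a solution at
  other times are unconstrained.\<close>

theorem theorem3p3:
  fixes T \<sigma> \<sigma>\<^sub>0 a r :: real
  assumes "T > 0" and "\<sigma> > 0" and "\<sigma>\<^sub>0 > 0" and "a \<ge> 0"
  shows "\<exists>f. admissible_solution T \<sigma> \<sigma>\<^sub>0 a r f \<and>
           (\<forall>g. admissible_solution T \<sigma> \<sigma>\<^sub>0 a r g \<longrightarrow> (\<forall>t\<in>{0..T}. \<forall>y. g t y = f t y)) \<and>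
           (\<forall>t\<in>{0..T}. \<forall>y. (\<lambda>x. f t x) differentiable (at y)) \<and>
           (\<exists>C\<^sub>2>0. \<forall>y. \<forall>t\<in>{0..T}. \<bar>D_y f t y\<bar> \<le> C\<^sub>2 * (1 + \<bar>y\<bar>))"
proof -
  obtain f where f: "admissible_solution T \<sigma> \<sigma>\<^sub>0 a r f"
    "\<forall>t\<in>{0..T}. \<forall>y. (\<lambda>x. f t x) differentiable (at y)"
    "\<exists>C\<^sub>2>0. \<forall>y. \<forall>t\<in>{0..T}. \<bar>D_y f t y\<bar> \<le> C\<^sub>2 * (1 + \<bar>y\<bar>)"
    using admissible_solution_exists[OF assms(1-3)] by blast
  have "g t y = f t y" if "admissible_solution T \<sigma> \<sigma>\<^sub>0 a r g" "t \<in> {0..T}" for g t y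
    using admissible_solution_le[OF assms(1-3) f(1) that(1,2)]
      admissible_solution_le[OF assms(1-3) that(1) f(1) that(2)] by (rule antisym)
  then show ?thesis using f by blast
qed

end
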